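(* Let $D = (D_{ij})$ be an $m \times m$ matrix of differences and let $F = (f_{ij})$ be a non-degenerate self-conjugate $m \times m$ matrix of Laurent polynomials majorized by $D$. Then \[ \alpha(D) \leq \min(\rho_+(F), \rho_-(F)). \]
   Context: An $m\times m$ matrix of differences is a matrix $D = (D_{ij})$ of finite subsets of $\mathbb{Z}$ with $D_{ji} = -D_{ij}$ for all $i,j$. The $m$-block circulant graph $G_n$ with matrix of differences $D$ has vertex set $\{(i,u) : 0 \leq i \leq m-1,\ 0 \leq u \leq n-1\}$, and $(i,u)$, $(j,v)$ (possibly equal) are adjacent iff $v - u$ is congruent modulo $n$ to some element of $D_{ij}$. $\alpha(G)$ is the maximum size of an independent set (no two adjacent vertices, no looped vertex), and $\alpha(D) := \lim_{n\to\infty} \alpha(G_n)/(nm)$ (this limit exists). For a Laurent polynomial $g(z) = \sum_k c_k z^k$ its conjugate is $\overline{g}(z) = \sum_k \overline{c_k} z^{-k}$. A matrix $F = (f_{ij})$ of Laurent polynomials in $z$ is self-conjugate if $f_{ji} = \overline{f_{ij}}$ for all $i,j$ (so $F(z)$ is Hermitian for $|z|=1$); it is non-degenerate if $\det F$ is a non-zero Laurent polynomial; it is majorized by $D$ if each $f_{ij}$ has the form $\sum_{d \in D_{ij}} c_d z^d$. Define $\rho_+(F) = \frac{1}{2\pi m}\int_0^{2\pi} N_+(\theta)\, d\theta$ and $\rho_-(F) = \frac{1}{2\pi m}\int_0^{2\pi} N_-(\theta)\, d\theta$, where $N_+(\theta)$ (resp. $N_-(\theta)$) is the number of positive (resp.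 negative) eigenvalues of the Hermitian matrix $F(e^{i\theta})$ counted with multiplicity. *)

theory Defs
  imports "HOL-Analysis.Analysis" "HOL-Library.Poly_Mapping" "Jordan_Normal_Form.Char_Poly"
begin

definition diff_matrix :: "nat \<Rightarrow> (nat \<Rightarrow> nat \<Rightarrow> int set) \<Rightarrow> bool" where
  "diff_matrix m D \<longleftrightarrow> (\<forall>i<m. \<forall>j<m. finite (D i j) \<and> D j i = uminus ` D i j)"

definition bc_vertices :: "nat \<Rightarrow> nat \<Rightarrow> (nat \<times> nat) set" where
  "bc_vertices m n = {(i, u). i < m \<and> u < n}"

(* adjacency of (i,u) and (j,v) in G_n (possibly equal vertices: loops) *)
definition bc_adj :: "(nat \<Rightarrow> nat \<Rightarrow> int set) \<Rightarrow> nat \<Rightarrow> nat \<times> nat \<Rightarrow> nat \<times> nat \<Rightarrow> bool" where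
  "bc_adj D n x y \<longleftrightarrow> (\<exists>d \<in> D (fst x) (fst y). (int (snd y) - int (snd x)) mod int n = d mod int n)"

definition bc_independent :: "nat \<Rightarrow> (nat \<Rightarrow> nat \<Rightarrow> int set) \<Rightarrow> nat \<Rightarrow> (nat \<times> nat) set \<Rightarrow> bool" where
  "bc_independent m D n S \<longleftrightarrow> S \<subseteq> bc_vertices m n \<and> (\<forall>x\<in>S. \<forall>y\<in>S. \<not> bc_adj D n x y)"

definition bc_alpha :: "nat \<Rightarrow> (nat \<Rightarrow> nat \<Rightarrow> int set) \<Rightarrow> nat \<Rightarrow> nat" where
  "bc_alpha m D n = Max (card ` {S. bc_independent m D n S})"

definition alpha_D :: "nat \<Rightarrow> (nat \<Rightarrow> nat \<Rightarrow> int set) \<Rightarrow> real" where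
  "alpha_D m D = lim (\<lambda>n. real (bc_alpha m D n) / (real n * real m))"

(* Laurent polynomials in z over C: finitely supported coefficient maps int \<Rightarrow>\<^sub>0 complex
   (the group ring of Z, multiplication is convolution). *)
type_synonym laurent = "int \<Rightarrow>\<^sub>0 complex"

definition laurent_eval :: "laurent \<Rightarrow> complex \<Rightarrow> complex" where
  "laurent_eval g z = (\<Sum>k\<in>Poly_Mapping.keys g. Poly_Mapping.lookup g k * z powi k)"

definition laurent_cnj :: "laurent \<Rightarrow> laurent" where
  "laurent_cnj g = Abs_poly_mapping (\<lambda>k. cnj (Poly_Mapping.lookup g (- k)))"

definition self_conjugate :: "nat \<Rightarrow> (nat \<Rightarrow> nat \<Rightarrow> laurent) \<Rightarrow> bool" where
  "self_conjugate m F \<longleftrightarrow> (\<forall>i<m. \<forall>j<m. F j i = laurent_cnj (F i j))"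

definition laurent_mat :: "nat \<Rightarrow> (nat \<Rightarrow> nat \<Rightarrow> laurent) \<Rightarrow> laurent mat" where
  "laurent_mat m F = mat m m (\<lambda>(i, j). F i j)"

definition non_degenerate :: "nat \<Rightarrow> (nat \<Rightarrow> nat \<Rightarrow> laurent) \<Rightarrow> bool" where
  "non_degenerate m F \<longleftrightarrow> det (laurent_mat m F) \<noteq> 0"

definition majorized :: "nat \<Rightarrow> (nat \<Rightarrow> nat \<Rightarrow> laurent) \<Rightarrow> (nat \<Rightarrow> nat \<Rightarrow> int set) \<Rightarrow> bool" where
  "majorized m F D \<longleftrightarrow> (\<forall>i<m. \<forall>j<m. Poly_Mapping.keys (F i j) \<subseteq> D i j)"

definition eval_mat :: "nat \<Rightarrow> (nat \<Rightarrow> nat \<Rightarrow> laurent) \<Rightarrow> real \<Rightarrow> complex mat" where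
  "eval_mat m F \<theta> = mat m m (\<lambda>(i, j). laurent_eval (F i j) (cis \<theta>))"

definition num_pos_eig :: "complex mat \<Rightarrow> nat" where
  "num_pos_eig A = (\<Sum>x\<in>{x. x \<in> \<real> \<and> Re x > 0 \<and> eigenvalue A x}. order x (char_poly A))"

definition num_neg_eig :: "complex mat \<Rightarrow> nat" where
  "num_neg_eig A = (\<Sum>x\<in>{x. x \<in> \<real> \<and> Re x < 0 \<and> eigenvalue A x}. order x (char_poly A))"

definition rho_plus :: "nat \<Rightarrow> (nat \<Rightarrow> nat \<Rightarrow> laurent) \<Rightarrow> real" where
  "rho_plus m F = integral {0..2*pi} (\<lambda>\<theta>. real (num_pos_eig (eval_mat m F \<theta>))) / (2 * pi * real m)"

definition rho_minus :: "nat \<Rightarrow> (nat \<Rightarrow> nat \<Rightarrow> laurent) \<Rightarrow> real" where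
  "rho_minus m F = integral {0..2*pi} (\<lambda>\<theta>. real (num_neg_eig (eval_mat m F \<theta>))) / (2 * pi * real m)"

end

theory Submission
  imports Defs "Jordan_Normal_Form.Schur_Decomposition"
begin

text \<open>
  Let \<open>S\<close> be an independent set whose second coordinates lie in \<open>[0, n)\<close>, and let \<open>L\<close> bound
  the differences. A vector \<open>x\<close> supported on \<open>S\<close> annihilates the block Toeplitz form with symbol
  \<open>F\<close>. With \<open>N = n + L\<close> that form is exactly the average of the forms of
  \<open>F(e\<^sup>i\<^sup>\<theta>)\<close> at the discrete Fourier transforms of \<open>x\<close>, taken over the points
  \<open>\<theta>\<^sub>k = (2\<pi>k + \<phi>) / N\<close>, for every shift \<open>\<phi>\<close>. Requiring the transform at each \<open>\<theta>\<^sub>k\<close> to be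
  orthogonal to the eigenvectors with eigenvalue \<open>\<le> 0\<close> costs \<open>\<Sum>\<^sub>k (m - N\<^sub>+(\<theta>\<^sub>k))\<close> linear
  equations and makes all the forms positive definite, so
  \<open>|S| \<le> \<Sum>\<^sub>k (m - N\<^sub>+(\<theta>\<^sub>k))\<close>. Averaging over \<open>\<phi>\<close> turns the sum into an integral without any
  discussion of Riemann sums, and \<open>m - N\<^sub>+ = N\<^sub>-\<close> off the finitely many zeros of \<open>det F\<close>.
\<close>

unbundle no vec_syntax
hide_const (open) Coset.order

section \<open>The spectral theorem for Hermitian matrices\<close>

definition adjoint_mat :: "complex mat \<Rightarrow> complex mat" where
  "adjoint_mat A = transpose_mat (map_mat cnj A)"

lemma adjoint_mat_carrier [simp]: "A \<in> carrier_mat n k \<Longrightarrow> adjoint_mat A \<in> carrier_mat k n"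
  by (simp add: adjoint_mat_def)

lemma adjoint_mat_dim [simp]:
  "dim_row (adjoint_mat A) = dim_col A" "dim_col (adjoint_mat A) = dim_row A"
  by (simp_all add: adjoint_mat_def)

lemma index_adjoint_mat [simp]:
  "i < dim_col A \<Longrightarrow> j < dim_row A \<Longrightarrow> adjoint_mat A $$ (i, j) = cnj (A $$ (j, i))"
  by (simp add: adjoint_mat_def)

lemma adjoint_mat_adjoint [simp]: "adjoint_mat (adjoint_mat A) = A"
  by (rule eq_matI) auto

lemma adjoint_mat_mult:
  assumes "A \<in> carrier_mat n k" "B \<in> carrier_mat k l"
  shows "adjoint_mat (A * B) = adjoint_mat B * adjoint_mat A"
proof -
  interpret comm_ring_hom cnj by unfold_locales auto
  show ?thesis
    unfolding adjoint_mat_def mat_hom_mult[OF assms] using assms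
    by (subst transpose_mult[of _ n k _ l]) auto
qed

text \<open>Completing \<open>v\<close> to a basis and applying Gram-Schmidt keeps \<open>v\<close>
  in first position. Normalizing the resulting orthogonal vectors rescales it, whence the factor
  \<open>c\<close>.\<close>

lemma unitary_first_column:
  assumes v: "v \<in> carrier_vec n" and v0: "v \<noteq> (0\<^sub>v n :: complex vec)" and n: "n \<noteq> 0"
  obtains U c where "U \<in> carrier_mat n n" "adjoint_mat U * U = 1\<^sub>m n" "col U 0 = c \<cdot>\<^sub>v v"
proof -
  define b where "b = basis_completion v"
  define ws where "ws = gram_schmidt n b"
  interpret cof_vec_space n "TYPE(complex)" .
  from basis_completion[OF v v0, folded b_def]
  have dist_b: "distinct b" and indep: "\<not> lin_dep (set b)" and b: "set b \<subseteq> carrier_vec n"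
    and hdb: "hd b = v" and len_b: "length b = n" by auto
  from hdb len_b n obtain vs where bv: "b = v # vs" by (cases b, auto)
  from gram_schmidt_result[OF b dist_b indep refl, folded ws_def]
  have ws: "set ws \<subseteq> carrier_vec n" "corthogonal ws" "length ws = n"
    by (auto simp: len_b)
  have hdws: "hd ws = v" using gram_schmidt_hd[OF v, of vs, folded bv] by (simp add: ws_def)
  have ws_c: "ws ! j \<in> carrier_vec n" if "j < n" for j using ws that by auto
  \<comment> \<open>The squared norms of the orthogonal basis vectors; corthogonality makes them
    nonzero, so the columns of \<open>U\<close> may be divided by their square roots.\<close>
  define r where "r j = (\<Sum>i<n. (norm (ws ! j $ i))\<^sup>2)" for j
  have sp: "ws ! j \<bullet>c ws ! k = (\<Sum>i<n. ws ! j $ i * cnj (ws ! k $ i))" if "j < n" "k < n" for j k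
    using ws_c[OF that(1)] ws_c[OF that(2)] by (simp add: scalar_prod_def lessThan_atLeast0)
  have spr: "ws ! j \<bullet>c ws ! j = of_real (r j)" if "j < n" for j
    unfolding sp[OF that that] r_def of_real_sum by (intro sum.cong refl) (simp only: complex_norm_square)
  have r0: "r j > 0" if "j < n" for j
  proof -
    have "r j \<noteq> 0" using corthogonalD[OF ws(2), of j j] spr[OF that] that ws(3) by auto
    moreover have "r j \<ge> 0" unfolding r_def by (intro sum_nonneg) auto
    ultimately show ?thesis by simp
  qed
  define U where "U = mat n n (\<lambda>(i, j). ws ! j $ i / of_real (sqrt (r j)))"
  have U: "U \<in> carrier_mat n n" by (simp add: U_def)
  have "adjoint_mat U * U = 1\<^sub>m n"
  proof (rule eq_matI)
    fix i j assume "i < dim_row (1\<^sub>m n)" "j < dim_col (1\<^sub>m n)"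
    hence ij: "i < n" "j < n" by auto
    have "(adjoint_mat U * U) $$ (i, j) = (\<Sum>k<n. cnj (U $$ (k, i)) * U $$ (k, j))"
      using U ij by (simp add: scalar_prod_def lessThan_atLeast0)
    also have "\<dots> = (\<Sum>k<n. ws ! j $ k * cnj (ws ! i $ k)) / of_real (sqrt (r i) * sqrt (r j))"
      unfolding U_def sum_divide_distrib using ij by (intro sum.cong) auto
    also have "\<dots> = ws ! j \<bullet>c ws ! i / of_real (sqrt (r i) * sqrt (r j))"
      using ij by (simp add: sp)
    also have "\<dots> = 1\<^sub>m n $$ (i, j)"
    proof (cases "i = j")
      case True
      have "sqrt (r j) * sqrt (r j) = r j" using r0[of j] ij by simp
      thus ?thesis using True ij spr[of j] r0[of j] by simp
    next
      case False
      thus ?thesis using corthogonalD[OF ws(2), of j i] ij ws(3) by auto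
    qed
    finally show "(adjoint_mat U * U) $$ (i, j) = 1\<^sub>m n $$ (i, j)" .
  qed (use U in auto)
  moreover have "ws \<noteq> []" using ws(3) n by auto
  hence "ws ! 0 = v" using hdws by (simp add: hd_conv_nth)
  hence "col U 0 = (1 / of_real (sqrt (r 0))) \<cdot>\<^sub>v v"
    using n v by (intro eq_vecI) (auto simp: U_def)
  ultimately show ?thesis using U that by blast
qed

text \<open>Induction by deflation. In an orthonormal basis that starts with an eigenvector, the
  first column is a multiple of the first unit vector. Hermitian symmetry does the same to the first
  row and makes the eigenvalue real, so a Hermitian block of size \<open>n\<close> remains.\<close>

theorem spectral_theorem:
  assumes "A \<in> carrier_mat n n" "adjoint_mat A = A"
  shows "\<exists>U ls. U \<in> carrier_mat n n \<and> adjoint_mat U * U = 1\<^sub>m n \<and>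
    adjoint_mat U * A * U = mat n n (\<lambda>(i, j). if i = j then of_real (ls i) else 0)"
  using assms
proof (induction n arbitrary: A)
  case 0
  show ?case
    by (rule exI[of _ "1\<^sub>m 0"], rule exI[of _ "\<lambda>_. 0"]) (auto intro!: eq_matI)
next
  case (Suc n)
  note A = Suc.prems(1) and hA = Suc.prems(2)
  \<comment> \<open>Over the complex numbers the characteristic polynomial splits into
    \<open>Suc n\<close> linear factors, so there is at least one root.\<close>
  obtain e where e: "eigenvalue A e"
    using char_poly_factorized[OF A] eigenvalue_root_char_poly[OF A]
    by (metis length_Suc_conv linear_poly_root list.set_intros(1))
  then obtain v where "eigenvector A v e" unfolding eigenvalue_def by auto
  hence v: "v \<in> carrier_vec (Suc n)" "v \<noteq> 0\<^sub>v (Suc n)" "A *\<^sub>v v = e \<cdot>\<^sub>v v"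
    using A unfolding eigenvector_def by auto
  obtain W c where W: "W \<in> carrier_mat (Suc n) (Suc n)" and WW: "adjoint_mat W * W = 1\<^sub>m (Suc n)"
    and c: "col W 0 = c \<cdot>\<^sub>v v"
    using unitary_first_column[OF v(1,2)] by blast
  define B where "B = adjoint_mat W * A * W"
  have B: "B \<in> carrier_mat (Suc n) (Suc n)" unfolding B_def using adjoint_mat_carrier[OF W] A W by (meson mult_carrier_mat)
  have hB: "adjoint_mat B = B"
    unfolding B_def using A W hA
    by (simp add: adjoint_mat_mult[of _ "Suc n" "Suc n" _ "Suc n"] assoc_mult_mat[of _ "Suc n" "Suc n" _ "Suc n" _ "Suc n"])
  have "col B 0 = adjoint_mat W *\<^sub>v (A *\<^sub>v col W 0)"
    using A W unfolding B_def
    by (simp add: assoc_mult_mat[of _ "Suc n" "Suc n" _ "Suc n" _ "Suc n"]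
        col_mult2[of _ "Suc n" "Suc n" _ "Suc n"] mult_mat_vec_def)
  also have "A *\<^sub>v col W 0 = e \<cdot>\<^sub>v col W 0"
    unfolding c using v A by (simp add: mult_mat_vec[OF A v(1)] smult_smult_assoc mult.commute)
  also have "adjoint_mat W *\<^sub>v (e \<cdot>\<^sub>v col W 0) = e \<cdot>\<^sub>v (adjoint_mat W *\<^sub>v col W 0)"
    using W by (intro mult_mat_vec[of _ "Suc n" "Suc n"] carrier_vecI) auto
  also have "adjoint_mat W *\<^sub>v col W 0 = col (adjoint_mat W * W) 0"
    using W by (subst col_mult2[of _ "Suc n" "Suc n" _ "Suc n"]) auto
  finally have col0: "col B 0 = e \<cdot>\<^sub>v unit_vec (Suc n) 0" by (simp add: WW)
  have Bi0: "B $$ (i, 0) = (if i = 0 then e else 0)" if "i < Suc n" for i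
    using arg_cong[OF col0, of "\<lambda>v. v $ i"] that B by (auto simp: unit_vec_def)
  have Bsym: "B $$ (j, i) = cnj (B $$ (i, j))" if "i < Suc n" "j < Suc n" for i j
    using that B by (subst hB[symmetric]) simp
  have eR: "cnj e = e" using Bi0[of 0] Bsym[of 0 0] by (metis zero_less_Suc)
  have B0i: "B $$ (0, i) = (if i = 0 then e else 0)" if "i < Suc n" for i
    using Bi0[of i] Bi0[of 0] Bsym[of i 0] that by auto
  define C where "C = mat n n (\<lambda>(i, j). B $$ (Suc i, Suc j))"
  have C: "C \<in> carrier_mat n n" by (simp add: C_def)
  have Bblock: "B = four_block_mat (mat 1 1 (\<lambda>_. e)) (0\<^sub>m 1 n) (0\<^sub>m n 1) C"
    using B by (intro eq_matI) (auto simp: C_def Bi0 B0i not_less_eq less_Suc_eq_0_disj)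
  have "adjoint_mat C = C"
    by (intro eq_matI) (auto simp: C_def Bsym[symmetric])
  from Suc.IH[OF C this] obtain V ls where V: "V \<in> carrier_mat n n" and VV: "adjoint_mat V * V = 1\<^sub>m n"
    and VC: "adjoint_mat V * C * V = mat n n (\<lambda>(i, j). if i = j then of_real (ls i) else 0)"
    by blast
  \<comment> \<open>\<open>V\<close> diagonalizes the remaining block; \<open>V'\<close> extends it
    by fixing the first basis vector, and \<open>W * V'\<close> will diagonalize
    \<open>A\<close>.\<close>
  define V' where "V' = four_block_mat (1\<^sub>m 1) (0\<^sub>m 1 n) (0\<^sub>m n 1) V"
  have V': "V' \<in> carrier_mat (Suc n) (Suc n)" using V by (intro carrier_matI) (auto simp: V'_def)
  have aV': "adjoint_mat V' = four_block_mat (1\<^sub>m 1) (0\<^sub>m 1 n) (0\<^sub>m n 1) (adjoint_mat V)"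
    using V unfolding V'_def by (intro eq_matI) auto
  have m4: "four_block_mat A1 (0\<^sub>m 1 n) (0\<^sub>m n 1) D1 * four_block_mat A2 (0\<^sub>m 1 n) (0\<^sub>m n 1) D2
      = four_block_mat (A1 * A2) (0\<^sub>m 1 n) (0\<^sub>m n 1) (D1 * D2)"
    if "A1 \<in> carrier_mat 1 1" "A2 \<in> carrier_mat 1 1" "D1 \<in> carrier_mat n n" "D2 \<in> carrier_mat n n"
    for A1 A2 D1 D2 :: "complex mat"
    using that by (subst mult_four_block_mat[of _ 1 1 _ n _ n _ _ 1 _ n]) auto
  have "adjoint_mat V' * V' = 1\<^sub>m (Suc n)"
    unfolding aV' unfolding V'_def using V by (subst m4) (auto simp: VV)
  moreover have VB: "adjoint_mat V' * B * V' = four_block_mat (mat 1 1 (\<lambda>_. e)) (0\<^sub>m 1 n) (0\<^sub>m n 1) (adjoint_mat V * C * V)"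
    unfolding aV' unfolding V'_def Bblock using V C mult_carrier_mat[OF adjoint_mat_carrier[OF V] C]
    by (simp add: m4[unfolded One_nat_def])
  define ls' where "ls' i = (case i of 0 \<Rightarrow> Re e | Suc i \<Rightarrow> ls i)" for i
  have "of_real (Re e) = e" using eR by (simp add: complex_eq_iff)
  hence VB': "adjoint_mat V' * B * V' = mat (Suc n) (Suc n) (\<lambda>(i, j). if i = j then of_real (ls' i) else 0)"
    unfolding VB VC by (intro eq_matI) (auto simp: ls'_def split: nat.split)
  define U where "U = W * V'"
  have U: "U \<in> carrier_mat (Suc n) (Suc n)" using W V' by (simp add: U_def)
  have aU: "adjoint_mat U = adjoint_mat V' * adjoint_mat W"
    unfolding U_def using W V' by (rule adjoint_mat_mult)
  note mc = mult_carrier_mat[of _ "Suc n" "Suc n" _ "Suc n"]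
  note cc = W V' A adjoint_mat_carrier[OF W] adjoint_mat_carrier[OF V']
  note assoc = assoc_mult_mat[of _ "Suc n" "Suc n" _ "Suc n" _ "Suc n"]
  have "adjoint_mat U * U = adjoint_mat V' * (adjoint_mat W * W) * V'"
    unfolding aU unfolding U_def by (simp add: assoc mc cc del: adjoint_mat_carrier)
  hence "adjoint_mat U * U = 1\<^sub>m (Suc n)" using V' calculation by (simp add: WW)
  moreover have "adjoint_mat U * A * U = adjoint_mat V' * B * V'"
    unfolding aU unfolding U_def B_def by (simp add: assoc mc cc del: adjoint_mat_carrier)
  ultimately show ?case
    using U VB' by (intro exI[of _ U] exI[of _ ls'] conjI) simp_all
qed

section \<open>Linear systems, equispaced points, subadditive sequences\<close>

text \<open>Gaussian elimination, one equation and one unknown at a time. The index sets are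
  arbitrary, so that equations can be indexed by pairs or by disjoint sums of sets.\<close>

lemma homogeneous_system_nontrivial_solution:
  fixes c :: "'e \<Rightarrow> 's \<Rightarrow> 'a :: field"
  assumes "finite E" "finite S" "card E < card S"
  shows "\<exists>x. (\<exists>s\<in>S. x s \<noteq> 0) \<and> (\<forall>s. s \<notin> S \<longrightarrow> x s = 0) \<and> (\<forall>e\<in>E. (\<Sum>s\<in>S. c e s * x s) = 0)"
  using assms
proof (induction E arbitrary: S c rule: finite_induct)
  case empty
  then obtain s where "s \<in> S" by fastforce
  thus ?case by (intro exI[of _ "\<lambda>t. if t = s then 1 else 0"]) auto
next
  case (insert e E)
  have cE: "card E < card S" using insert by simp
  show ?case
  proof (cases "\<forall>s\<in>S. c e s = 0")
    case True
    obtain x where "\<exists>s\<in>S. x s \<noteq> 0" "\<forall>s. s \<notin> S \<longrightarrow> x s = 0" "\<forall>f\<in>E. (\<Sum>s\<in>S. c f s * x s) = 0"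
      using insert.IH[OF insert.prems(1) cE, of c] by blast
    moreover have "(\<Sum>s\<in>S. c e s * x s) = 0" using True by simp
    ultimately show ?thesis by blast
  next
    case False
    then obtain p where p: "p \<in> S" "c e p \<noteq> 0" by blast
    \<comment> \<open>The pivot \<open>p\<close> is eliminated: subtracting
      \<open>c f p / c e p\<close> times equation \<open>e\<close> from equation \<open>f\<close>
      removes the unknown at \<open>p\<close>.\<close>
    have "card E < card (S - {p})" using insert p by (simp add: card_Diff_singleton)
    then obtain x where x: "\<exists>s\<in>S - {p}. x s \<noteq> 0" "\<forall>s. s \<notin> S - {p} \<longrightarrow> x s = 0"
      "\<forall>f\<in>E. (\<Sum>s\<in>S - {p}. (c f s - c f p / c e p * c e s) * x s) = 0"
      using insert.IH[of "S - {p}" "\<lambda>f s. c f s - c f p / c e p * c e s"] insert.prems by auto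
    define t where "t = (\<Sum>s\<in>S - {p}. c e s * x s)"
    \<comment> \<open>The value at \<open>p\<close> is read off from equation
      \<open>e\<close>.\<close>
    define y where "y = x(p := - t / c e p)"
    have sumy: "(\<Sum>s\<in>S. c f s * y s) = (\<Sum>s\<in>S - {p}. c f s * x s) - c f p * t / c e p" for f
    proof -
      have "(\<Sum>s\<in>S - {p}. c f s * y s) = (\<Sum>s\<in>S - {p}. c f s * x s)"
        by (intro sum.cong) (auto simp: y_def)
      thus ?thesis using insert.prems p(1) by (simp add: sum.remove[of S p] y_def)
    qed
    have "(\<Sum>s\<in>S. c f s * y s) = 0" if "f \<in> E" for f
    proof -
      have "0 = (\<Sum>s\<in>S - {p}. c f s * x s - c f p / c e p * (c e s * x s))"
        using x(3) that by (simp add: left_diff_distrib mult.assoc)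
      thus ?thesis
        unfolding sumy by (simp add: sum_subtractf t_def sum_distrib_left sum_divide_distrib)
    qed
    moreover have "(\<Sum>s\<in>S. c e s * y s) = 0"
      unfolding sumy using p(2) by (simp add: t_def)
    moreover have "\<exists>s\<in>S. y s \<noteq> 0" using x(1) by (auto simp: y_def)
    moreover have "\<forall>s. s \<notin> S \<longrightarrow> y s = 0" using x(2) p by (auto simp: y_def)
    ultimately show ?thesis by blast
  qed
qed

text \<open>A geometric series whose ratio \<open>q\<close> is an \<open>N\<close>-th root of unity.
  The bound on \<open>w\<close> excludes nonzero multiples of \<open>N\<close>, so
  \<open>q = 1\<close> only for \<open>w = 0\<close>; the shift \<phi> contributes a factor common
  to all terms.\<close>

lemma sum_cis_equispaced:
  fixes w :: int
  assumes "\<bar>w\<bar> < int N"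
  shows "(\<Sum>k<N. cis (of_int w * ((2 * pi * real k + \<phi>) / real N))) = (if w = 0 then of_nat N else 0)"
proof (cases "w = 0")
  case False
  define q where "q = cis (2 * pi * of_int w / real N)"
  have N: "N > 0" using assms by auto
  have "q ^ N = 1"
    using N by (simp add: q_def Complex.DeMoivre cis_multiple_2pi)
  moreover have "q \<noteq> 1"
  proof
    assume "q = 1"
    hence "cos (2 * pi * of_int w / real N) = 1" unfolding q_def by (metis cis.sel(1) one_complex.sel(1))
    then obtain l :: int where "2 * pi * of_int w / real N = of_int l * 2 * pi"
      by (auto simp: cos_one_2pi_int)
    hence "of_int w = (of_int l * real N :: real)" using N by (simp add: field_simps)
    hence "w = l * int N" by (metis of_int_eq_iff of_int_mult of_int_of_nat_eq)
    hence "\<bar>w\<bar> \<ge> int N" using False by (auto simp: abs_mult)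
    thus False using assms by simp
  qed
  ultimately have "(\<Sum>k<N. q ^ k) = 0" by (simp add: sum_gp_strict)
  moreover have "cis (of_int w * ((2 * pi * real k + \<phi>) / real N)) = cis (of_int w * \<phi> / real N) * q ^ k" for k
    unfolding q_def Complex.DeMoivre cis_mult by (rule arg_cong[of _ _ cis]) (use N in \<open>simp add: field_simps\<close>)
  ultimately show ?thesis using False by (simp add: sum_distrib_left[symmetric])
qed auto

text \<open>Fekete's lemma: the quotients converge to their infimum over \<open>n\<close> \<ge> 1,
  as seen by dividing \<open>n\<close> with remainder by a nearly optimal \<open>p\<close>.\<close>

lemma subadditive_limit:
  fixes a :: "nat \<Rightarrow> real"
  assumes sub: "\<And>n k. a (n + k) \<le> a n + a k" and nonneg: "\<And>n. a n \<ge> 0"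
  shows "convergent (\<lambda>n. a n / real n)"
proof -
  define X where "X = (\<lambda>n. a n / real n) ` {1..}"
  define c where "c = Inf X"
  have bdd: "bdd_below X" unfolding X_def by (rule bdd_belowI[of _ 0]) (auto simp: nonneg)
  \<comment> \<open>The summand \<open>a 0\<close> covers \<open>q = 0\<close>, since subadditivity
    does not make \<open>a 0\<close> vanish.\<close>
  have mult: "a (q * p) \<le> real q * a p + a 0" for q p
    by (induction q) (use sub[of p "_ * p"] in \<open>auto simp: algebra_simps intro: order.trans[OF sub]\<close>)
  have "(\<lambda>n. a n / real n) \<longlonglongrightarrow> c"
  proof (rule LIMSEQ_I)
    fix \<epsilon> :: real assume \<epsilon>: "\<epsilon> > 0"
    have "\<exists>x\<in>X. x < c + \<epsilon> / 2" unfolding c_def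
      by (rule cInf_lessD) (use \<epsilon> in \<open>auto simp: X_def\<close>)
    then obtain p where p: "p \<ge> 1" "a p / real p < c + \<epsilon> / 2" unfolding X_def by auto
    \<comment> \<open>Bounds \<open>a 0\<close> and the remainder \<open>a (n mod p)\<close>
      together, uniformly in \<open>n\<close>.\<close>
    define M where "M = a 0 + (\<Sum>r<p. a r)"
    obtain n0 :: nat where n0: "real n0 > 2 * M / \<epsilon>" using reals_Archimedean2 by blast
    show "\<exists>no. \<forall>n\<ge>no. norm (a n / real n - c) < \<epsilon>"
    proof (intro exI[of _ "max n0 1"] allI impI)
      fix n assume n: "n \<ge> max n0 1"
      have "c \<le> a n / real n" unfolding c_def by (rule cInf_lower[OF _ bdd]) (use n in \<open>auto simp: X_def\<close>)
      have "a n \<le> a (n div p * p) + a (n mod p)" using sub[of "n div p * p" "n mod p"] by simp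
      also have "\<dots> \<le> real (n div p) * a p + a 0 + a (n mod p)" using mult[of "n div p" p] by simp
      also have "a (n mod p) \<le> (\<Sum>r<p. a r)" using p by (intro member_le_sum) (auto simp: nonneg)
      also have "real (n div p) * a p \<le> real n / real p * a p"
        by (intro mult_right_mono of_nat_div_le_of_nat nonneg)
      finally have "a n \<le> real n * (a p / real p) + M" by (simp add: M_def)
      hence "a n / real n \<le> a p / real p + M / real n" using n by (simp add: field_simps)
      moreover have "M / real n < \<epsilon> / 2"
      proof -
        have "2 * M / \<epsilon> < real n" using n0 n by linarith
        thus ?thesis using \<epsilon> n by (simp add: field_simps)
      qed
      ultimately show "norm (a n / real n - c) < \<epsilon>" using p(2) \<open>c \<le> a n / real n\<close> by (simp only: real_norm_def abs_less_iff) linarith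
    qed
  qed
  thus ?thesis by (auto simp: convergent_def)
qed

section \<open>Evaluation of Laurent polynomials\<close>

lemma laurent_eval_superset:
  assumes "finite K" "Poly_Mapping.keys g \<subseteq> K"
  shows "laurent_eval g z = (\<Sum>k\<in>K. Poly_Mapping.lookup g k * z powi k)"
  unfolding laurent_eval_def using assms
  by (intro sum.mono_neutral_left) (auto simp: in_keys_iff)

lemma laurent_eval_single [simp]: "laurent_eval (Poly_Mapping.single k a) z = a * z powi k"
  by (subst laurent_eval_superset[of "{k}"]) auto

lemma laurent_eval_zero [simp]: "laurent_eval 0 z = 0"
  by (simp add: laurent_eval_def)

lemma laurent_eval_add: "laurent_eval (f + g) z = laurent_eval f z + laurent_eval g z"
proof -
  let ?K = "Poly_Mapping.keys f \<union> Poly_Mapping.keys g"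
  have "Poly_Mapping.keys (f + g) \<subseteq> ?K" by (rule Poly_Mapping.keys_add)
  thus ?thesis
    by (simp add: laurent_eval_superset[of ?K] lookup_add sum.distrib algebra_simps)
qed

lemma laurent_eval_sum: "laurent_eval (\<Sum>i\<in>I. f i) z = (\<Sum>i\<in>I. laurent_eval (f i) z)"
  by (induction I rule: infinite_finite_induct) (auto simp: laurent_eval_add)

lemma laurent_eval_mult:
  assumes "z \<noteq> 0"
  shows "laurent_eval (f * g) z = laurent_eval f z * laurent_eval g z"
proof -
  have dec: "h = (\<Sum>k\<in>Poly_Mapping.keys h. Poly_Mapping.single k (Poly_Mapping.lookup h k))" for h :: laurent
    by (rule poly_mapping_eqI) (auto simp: lookup_sum lookup_single when_def in_keys_iff)
  have "f * g = (\<Sum>k\<in>Poly_Mapping.keys f. \<Sum>l\<in>Poly_Mapping.keys g.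
     Poly_Mapping.single (k + l) (Poly_Mapping.lookup f k * Poly_Mapping.lookup g l))"
    by (subst dec[of f], subst dec[of g]) (simp add: sum_product mult_single)
  thus ?thesis using assms
    by (simp add: laurent_eval_sum power_int_add laurent_eval_def[of f] laurent_eval_def[of g] sum_product algebra_simps)
qed

text \<open>Ring homomorphisms commute with determinants, which will relate \<open>det F\<close> to
  the determinants of the evaluated matrices.\<close>

lemma laurent_eval_hom:
  assumes "z \<noteq> 0"
  shows "comm_ring_hom (\<lambda>g. laurent_eval g z)"
proof 
  show "laurent_eval 1 z = 1" using laurent_eval_single[of 0 1 z] by (simp add: one_poly_mapping.abs_eq del: laurent_eval_single)
qed (auto simp: laurent_eval_add laurent_eval_mult assms)

text \<open>Dividing by \<open>z powi l\<close>, with \<open>l\<close> the lowest exponent, leaves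
  an ordinary polynomial with nonzero constant coefficient and the same zeros away from 0.\<close>

lemma finite_laurent_zeros:
  assumes "g \<noteq> 0"
  shows "finite {z. z \<noteq> 0 \<and> laurent_eval g z = 0}"
proof -
  define K where "K = Poly_Mapping.keys g"
  have K: "finite K" "K \<noteq> {}" using assms by (auto simp: K_def)
  define l where "l = Min K"
  have l: "l \<le> k" if "k \<in> K" for k using that K by (simp add: l_def)
  define p where "p = (\<Sum>k\<in>K. monom (Poly_Mapping.lookup g k) (nat (k - l)))"
  have "coeff p 0 = (\<Sum>k\<in>K. if k = l then Poly_Mapping.lookup g k else 0)"
    unfolding p_def coeff_sum by (intro sum.cong) (use l in force)+
  also have "\<dots> = Poly_Mapping.lookup g l" using K by (simp add: l_def)
  also have "\<dots> \<noteq> 0" using K Min_in[of K] by (simp add: l_def K_def in_keys_iff)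
  finally have "p \<noteq> 0" by auto
  moreover have "poly p z = laurent_eval g z * z powi (- l)" if "z \<noteq> 0" for z
  proof -
    have "z ^ nat (k - l) = z powi k * z powi (- l)" if "k \<in> K" for k
    proof -
      have "z ^ nat (k - l) = z powi (k + - l)" using l[OF that] by (simp add: power_int_def)
      also have "\<dots> = z powi k * z powi (- l)" using \<open>z \<noteq> 0\<close> by (subst power_int_add) auto
      finally show ?thesis .
    qed
    thus ?thesis
      unfolding p_def laurent_eval_def K_def[symmetric]
      by (simp add: poly_sum poly_monom sum_distrib_right mult.assoc)
  qed
  ultimately show ?thesis
    by (intro finite_subset[OF _ poly_roots_finite[of p]]) auto
qed

section \<open>Inertia of Hermitian matrices\<close>

lemma order_prod_linear:
  "order x (\<Prod>a\<leftarrow>as. [:- a, 1:]) = count_list as (x :: 'a :: field)"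
proof (induction as)
  case (Cons a as)
  have "(\<Prod>a\<leftarrow>a # as. [:- a, 1:]) \<noteq> 0" by (subst prod_list_zero_iff) auto
  hence "order x (\<Prod>a\<leftarrow>a # as. [:- a, 1:]) = order x [:- a, 1:] + order x (\<Prod>a\<leftarrow>as. [:- a, 1:])"
    unfolding list.map prod_list.Cons by (rule order_mult)
  thus ?case unfolding Cons.IH order_linear' by auto
qed auto

lemma sum_count_list_Collect:
  "(\<Sum>x\<in>{x \<in> set as. P x}. count_list as x) = length (filter P as)"
proof -
  have "count_list as x = count_list (filter P as) x" if "P x" for x
    using that by (induction as) auto
  hence "(\<Sum>x\<in>{x \<in> set as. P x}. count_list as x) = (\<Sum>x\<in>set (filter P as). count_list (filter P as) x)"
    by (intro sum.cong) auto
  thus ?thesis by (simp add: sum_count_set)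
qed

text \<open>The sign parameter \<open>s\<close> is \<open>1\<close> or \<open>-1\<close> throughout, selecting the positive or
  the negative eigenvalues.\<close>

definition signed_eig :: "real \<Rightarrow> complex mat \<Rightarrow> nat" where
  "signed_eig s A = (\<Sum>x\<in>{x. x \<in> \<real> \<and> s * Re x > 0 \<and> eigenvalue A x}. order x (char_poly A))"

lemma num_pos_eig_eq: "num_pos_eig A = signed_eig 1 A"
  and num_neg_eig_eq: "num_neg_eig A = signed_eig (- 1) A"
  by (simp_all add: num_pos_eig_def num_neg_eig_def signed_eig_def)

text \<open>Turns algebraic multiplicities into a count of indices: the order of a root of the split
  polynomial is its number of occurrences in the list of eigenvalues.\<close>

lemma signed_eig_eq_card:
  assumes A: "A \<in> carrier_mat n n"
    and cp: "char_poly A = (\<Prod>a\<leftarrow>map (\<lambda>i. of_real (ls i)) [0..<n]. [:- a, 1:])"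
  shows "signed_eig s A = card {i. i < n \<and> s * ls i > 0}"
proof -
  define as where "as = map (\<lambda>i. complex_of_real (ls i)) [0..<n]"
  define P where "P x \<longleftrightarrow> x \<in> \<real> \<and> s * Re x > 0" for x
  have "eigenvalue A x \<longleftrightarrow> x \<in> set as" for x
    unfolding eigenvalue_root_char_poly[OF A] cp as_def[symmetric]
    by (auto simp: linear_poly_root poly_prod_list prod_list_zero_iff)
  hence "{x. x \<in> \<real> \<and> s * Re x > 0 \<and> eigenvalue A x} = {x \<in> set as. P x}" by (auto simp: P_def)
  hence "signed_eig s A = length (filter P as)"
    unfolding signed_eig_def cp as_def[symmetric] order_prod_linear by (simp add: sum_count_list_Collect)
  also have "\<dots> = card (set (filter (\<lambda>i. s * ls i > 0) [0..<n]))"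
    by (subst distinct_card) (auto simp: as_def filter_map o_def P_def)
  also have "set (filter (\<lambda>i. s * ls i > 0) [0..<n]) = {i. i < n \<and> s * ls i > 0}" by auto
  finally show ?thesis .
qed

definition qform :: "nat \<Rightarrow> complex mat \<Rightarrow> (nat \<Rightarrow> complex) \<Rightarrow> complex" where
  "qform m A x = (\<Sum>i<m. \<Sum>j<m. cnj (x i) * A $$ (i, j) * x j)"

lemma qform_diagonalized:
  assumes "\<And>i j. i < m \<Longrightarrow> j < m \<Longrightarrow> A $$ (i, j) = (\<Sum>a<m. of_real (l a) * U i a * cnj (U j a))"
  shows "qform m A x = of_real (\<Sum>a<m. l a * (cmod (\<Sum>i<m. cnj (U i a) * x i))\<^sup>2)"
proof -
  have "qform m A x = (\<Sum>i<m. \<Sum>j<m. \<Sum>a<m. of_real (l a) * (cnj (x i) * U i a) * (cnj (U j a) * x j))"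
    unfolding qform_def
    by (intro sum.cong refl) (simp add: assms sum_distrib_left sum_distrib_right algebra_simps)
  also have "\<dots> = (\<Sum>i<m. \<Sum>a<m. \<Sum>j<m. of_real (l a) * (cnj (x i) * U i a) * (cnj (U j a) * x j))"
    by (intro sum.cong refl sum.swap)
  also have "\<dots> = (\<Sum>a<m. \<Sum>i<m. \<Sum>j<m. of_real (l a) * (cnj (x i) * U i a) * (cnj (U j a) * x j))"
    by (rule sum.swap)
  also have "\<dots> = (\<Sum>a<m. of_real (l a) * (cnj (\<Sum>i<m. cnj (U i a) * x i) * (\<Sum>j<m. cnj (U j a) * x j)))"
    by (intro sum.cong refl) (simp add: sum_product sum_distrib_left algebra_simps)
  also have "\<dots> = (\<Sum>a<m. of_real (l a * (cmod (\<Sum>i<m. cnj (U i a) * x i))\<^sup>2))"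
    by (intro sum.cong refl) (simp only: of_real_mult complex_norm_square mult.commute[of "cnj _"])
  finally show ?thesis by simp
qed

text \<open>The spectral theorem in coordinates: Parseval's identity, the diagonal form, the inertia
  and the determinant. Later arguments about inertia use only these four facts.\<close>

lemma hermitian_diagonalization:
  assumes A: "A \<in> carrier_mat m m" and hA: "adjoint_mat A = A"
  obtains U l where
    "\<And>x. (\<Sum>i<m. (cmod (x i))\<^sup>2) = (\<Sum>a<m. (cmod (\<Sum>i<m. cnj (U i a) * x i))\<^sup>2)"
    "\<And>x. qform m A x = of_real (\<Sum>a<m. l a * (cmod (\<Sum>i<m. cnj (U i a) * x i))\<^sup>2)"
    "\<And>s. signed_eig s A = card {a. a < m \<and> s * l a > 0}"
    "det A = (\<Prod>a<m. of_real (l a))"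
proof -
  obtain V l where V: "V \<in> carrier_mat m m" and VV: "adjoint_mat V * V = 1\<^sub>m m"
    and VA: "adjoint_mat V * A * V = mat m m (\<lambda>(i, j). if i = j then of_real (l i) else 0)"
    using spectral_theorem[OF A hA] by blast
  define \<Delta> where "\<Delta> = mat m m (\<lambda>(i, j). if i = j then complex_of_real (l i) else 0)"
  have \<Delta>: "\<Delta> \<in> carrier_mat m m" by (simp add: \<Delta>_def)
  have V': "adjoint_mat V \<in> carrier_mat m m" using V by simp
  have VV': "V * adjoint_mat V = 1\<^sub>m m" using mat_mult_left_right_inverse[OF V' V VV] .
  note mc = mult_carrier_mat[of _ m m _ m]
  note assoc = assoc_mult_mat[of _ m m _ m _ m]
  have "V * \<Delta> * adjoint_mat V = V * (adjoint_mat V * A * V) * adjoint_mat V"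
    by (simp add: VA \<Delta>_def)
  also have "\<dots> = (V * adjoint_mat V) * A * (V * adjoint_mat V)"
    by (simp add: assoc mc V V' A del: adjoint_mat_carrier)
  finally have A_eq: "A = V * \<Delta> * adjoint_mat V" using A by (simp add: VV')
  have simw: "similar_mat_wit A \<Delta> V (adjoint_mat V)"
    using VV VV' A_eq A \<Delta> V V' by (intro similar_mat_witI)
  hence sim: "similar_mat A \<Delta>" by (auto simp: similar_mat_def)
  have ut: "upper_triangular \<Delta>" by (auto simp: \<Delta>_def)
  have dm: "diag_mat \<Delta> = map (\<lambda>i. of_real (l i)) [0..<m]" by (auto simp: diag_mat_def \<Delta>_def)
  have cp: "char_poly A = (\<Prod>a\<leftarrow>map (\<lambda>i. of_real (l i)) [0..<m]. [:- a, 1:])"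
    using char_poly_similar[OF sim] char_poly_upper_triangular[OF \<Delta> ut] dm by simp
  have "det A = det \<Delta>" using det_similar[OF sim] .
  also have "\<dots> = prod_list (diag_mat \<Delta>)" by (rule det_upper_triangular[OF ut \<Delta>])
  also have "\<dots> = (\<Prod>a<m. of_real (l a))"
    unfolding dm by (simp add: prod.distinct_set_conv_list[symmetric] lessThan_atLeast0)
  finally have det: "det A = (\<Prod>a<m. of_real (l a))" .
  define U where "U i a = V $$ (i, a)" for i a
  \<comment> \<open>Stated for an arbitrary diagonal \<open>l\<close>: the constant 1 gives the
    resolution of the identity behind Parseval, the eigenvalues give \<open>A\<close>
    itself.\<close>
  have entry: "(V * mat m m (\<lambda>(i, j). if i = j then complex_of_real (l i) else 0) * adjoint_mat V) $$ (i, j)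
     = (\<Sum>a<m. of_real (l a) * U i a * cnj (U j a))" if ij: "i < m" "j < m" for i j l
  proof -
    have "(V * mat m m (\<lambda>(i, j). if i = j then complex_of_real (l i) else 0)) $$ (i, a) = of_real (l a) * U i a"
      if "a < m" for a
    proof -
      have "(V * mat m m (\<lambda>(i, j). if i = j then complex_of_real (l i) else 0)) $$ (i, a)
        = (\<Sum>k<m. V $$ (i, k) * (if k = a then of_real (l k) else 0))"
        using V ij that by (simp add: scalar_prod_def lessThan_atLeast0)
      also have "\<dots> = (\<Sum>k<m. if k = a then V $$ (i, k) * of_real (l k) else 0)"
        by (intro sum.cong) auto
      finally show ?thesis using that by (simp add: U_def)
    qed
    thus ?thesis using V ij by (simp add: scalar_prod_def lessThan_atLeast0 U_def del: index_mult_mat) (simp add: scalar_prod_def lessThan_atLeast0)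
  qed
  have "mat m m (\<lambda>(i, j). if i = j then complex_of_real 1 else 0) = 1\<^sub>m m" by (intro eq_matI) auto
  hence one: "1\<^sub>m m $$ (i, j) = (\<Sum>a<m. of_real 1 * U i a * cnj (U j a))" if "i < m" "j < m" for i j
    using entry[OF that, of "\<lambda>_. 1"] V VV' by simp
  have "(\<Sum>i<m. (cmod (x i))\<^sup>2) = (\<Sum>a<m. (cmod (\<Sum>i<m. cnj (U i a) * x i))\<^sup>2)" for x
  proof -
    have "qform m (1\<^sub>m m) x = (\<Sum>i<m. \<Sum>j<m. if i = j then cnj (x i) * x j else 0)"
      unfolding qform_def by (intro sum.cong) auto
    also have "\<dots> = (\<Sum>i<m. of_real ((cmod (x i))\<^sup>2))"
    proof (rule sum.cong[OF refl])
      fix i assume "i \<in> {..<m}"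
      thus "(\<Sum>j<m. if i = j then cnj (x i) * x j else 0) = of_real ((cmod (x i))\<^sup>2)"
        unfolding complex_norm_square by (simp add: mult.commute)
    qed
    finally have "qform m (1\<^sub>m m) x = of_real (\<Sum>i<m. (cmod (x i))\<^sup>2)" by simp
    moreover have "qform m (1\<^sub>m m) x = of_real (\<Sum>a<m. 1 * (cmod (\<Sum>i<m. cnj (U i a) * x i))\<^sup>2)"
      by (rule qform_diagonalized) (rule one)
    ultimately show ?thesis by (simp only: of_real_eq_iff mult_1)
  qed
  moreover have "qform m A x = of_real (\<Sum>a<m. l a * (cmod (\<Sum>i<m. cnj (U i a) * x i))\<^sup>2)" for x
    by (rule qform_diagonalized) (use entry[of _ _ l] A_eq in \<open>simp add: \<Delta>_def\<close>)
  ultimately show ?thesis using that signed_eig_eq_card[OF A cp] det by blast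
qed

lemma signed_eig_le:
  assumes "A \<in> carrier_mat m m" "adjoint_mat A = A"
  shows "signed_eig s A \<le> m"
proof -
  obtain U l where U:
    "\<And>x. (\<Sum>i<m. (cmod (x i))\<^sup>2) = (\<Sum>a<m. (cmod (\<Sum>i<m. cnj (U i a) * x i))\<^sup>2)"
    "\<And>x. qform m A x = of_real (\<Sum>a<m. l a * (cmod (\<Sum>i<m. cnj (U i a) * x i))\<^sup>2)"
    "\<And>s. signed_eig s A = card {a. a < m \<and> s * l a > 0}"
    "det A = (\<Prod>a<m. of_real (l a))"
    by (rule hermitian_diagonalization[OF assms], rule that)
  have "card {a. a < m \<and> s * l a > 0} \<le> card {..<m}" by (intro card_mono) auto
  thus ?thesis by (simp add: U(3))
qed

text \<open>A nonzero determinant excludes the eigenvalue 0, so every eigenvalue has exactly one of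
  the two signs.\<close>

lemma signed_eig_complement:
  assumes "A \<in> carrier_mat m m" "adjoint_mat A = A" "det A \<noteq> 0" "s \<noteq> 0"
  shows "signed_eig s A + signed_eig (- s) A = m"
proof -
  obtain U l where U:
    "\<And>x. (\<Sum>i<m. (cmod (x i))\<^sup>2) = (\<Sum>a<m. (cmod (\<Sum>i<m. cnj (U i a) * x i))\<^sup>2)"
    "\<And>x. qform m A x = of_real (\<Sum>a<m. l a * (cmod (\<Sum>i<m. cnj (U i a) * x i))\<^sup>2)"
    "\<And>s. signed_eig s A = card {a. a < m \<and> s * l a > 0}"
    "det A = (\<Prod>a<m. of_real (l a))"
    by (rule hermitian_diagonalization[OF assms(1,2)], rule that)
  have nz: "l a \<noteq> 0" if "a < m" for a using U(4) assms(3) that by auto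
  have "signed_eig s A + signed_eig (- s) A =
    card ({a. a < m \<and> s * l a > 0} \<union> {a. a < m \<and> - s * l a > 0})"
    unfolding U(3) by (intro card_Un_disjoint[symmetric]) (auto simp: mult_less_0_iff zero_less_mult_iff)
  also have "{a. a < m \<and> s * l a > 0} \<union> {a. a < m \<and> - s * l a > 0} = {..<m}"
    using nz assms(4) by (auto simp: zero_less_mult_iff mult_less_0_iff) (metis linorder_neqE_linordered_idom)+
  finally show ?thesis by simp
qed

text \<open>The equations indexed by \<open>T\<close> demand orthogonality to the eigenvectors with
  \<open>s * l a\<close> \<le> 0. On the span of the others the signed form is bounded below by the
  least remaining \<open>s * l a\<close>.\<close>

lemma hermitian_definite_subspace:
  assumes "A \<in> carrier_mat m m" "adjoint_mat A = A"
  obtains T :: "nat set" and c \<mu> where "finite T" "card T + signed_eig s A = m" "\<mu> > 0"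
    "\<forall>x. (\<forall>a\<in>T. (\<Sum>i<m. c a i * x i) = (0::complex)) \<longrightarrow>
      s * Re (qform m A x) \<ge> \<mu> * (\<Sum>i<m. (cmod (x i))\<^sup>2)"
proof -
  obtain U l where U:
    "\<And>x. (\<Sum>i<m. (cmod (x i))\<^sup>2) = (\<Sum>a<m. (cmod (\<Sum>i<m. cnj (U i a) * x i))\<^sup>2)"
    "\<And>x. qform m A x = of_real (\<Sum>a<m. l a * (cmod (\<Sum>i<m. cnj (U i a) * x i))\<^sup>2)"
    "\<And>s. signed_eig s A = card {a. a < m \<and> s * l a > 0}"
    "det A = (\<Prod>a<m. of_real (l a))"
    by (rule hermitian_diagonalization[OF assms], rule that)
  define J where "J = {a. a < m \<and> s * l a > 0}"
  define T where "T = {..<m} - J"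
  \<comment> \<open>The inserted 1 keeps the set nonempty when \<open>J\<close> is empty, where the
    equations force all coordinates below \<open>m\<close> to vanish and any positive constant will
    do.\<close>
  define \<mu> where "\<mu> = Min (insert 1 ((\<lambda>a. s * l a) ` J))"
  have J: "J \<subseteq> {..<m}" "finite J" by (auto simp: J_def)
  have mu: "\<mu> > 0" using J unfolding \<mu>_def by (subst Min_gr_iff) (auto simp: J_def)
  have mu_le: "\<mu> \<le> s * l a" if "a \<in> J" for a
    using J that unfolding \<mu>_def by (intro Min_le) auto
  have cT: "card T + signed_eig s A = m"
    using card_Diff_subset[OF J(2,1)] card_mono[OF _ J(1)] unfolding U(3) J_def[symmetric] T_def by auto
  show ?thesis
  proof (rule that[where T = T and \<mu> = \<mu> and c = "\<lambda>a i. cnj (U i a)"])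
    show "\<forall>x. (\<forall>a\<in>T. (\<Sum>i<m. cnj (U i a) * x i) = 0) \<longrightarrow>
      s * Re (qform m A x) \<ge> \<mu> * (\<Sum>i<m. (cmod (x i))\<^sup>2)"
    proof (intro allI impI)
      fix x assume x: "\<forall>a\<in>T. (\<Sum>i<m. cnj (U i a) * x i) = 0"
      have "\<mu> * (cmod (\<Sum>i<m. cnj (U i a) * x i))\<^sup>2 \<le> s * l a * (cmod (\<Sum>i<m. cnj (U i a) * x i))\<^sup>2"
        if "a < m" for a
        using x[rule_format, of a] mu_le[of a] that by (cases "a \<in> J") (auto simp: T_def intro: mult_right_mono)
      hence "(\<Sum>a<m. \<mu> * (cmod (\<Sum>i<m. cnj (U i a) * x i))\<^sup>2) \<le> (\<Sum>a<m. s * l a * (cmod (\<Sum>i<m. cnj (U i a) * x i))\<^sup>2)"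
        by (intro sum_mono) auto
      thus "\<mu> * (\<Sum>i<m. (cmod (x i))\<^sup>2) \<le> s * Re (qform m A x)"
        unfolding U(1)[of x] U(2) by (simp add: sum_distrib_left mult.assoc)
    qed
  qed (use cT mu in \<open>auto simp: T_def\<close>)
qed

text \<open>The complementary choice: orthogonality to the eigenvectors with
  \<open>s * l a > 0\<close> leaves only nonpositive contributions.\<close>

lemma hermitian_nonpositive_subspace:
  assumes "A \<in> carrier_mat m m" "adjoint_mat A = A"
  obtains T :: "nat set" and c where "finite T" "card T = signed_eig s A"
    "\<forall>x. (\<forall>a\<in>T. (\<Sum>i<m. c a i * x i) = (0::complex)) \<longrightarrow> s * Re (qform m A x) \<le> 0"
proof -
  obtain U l where U:
    "\<And>x. (\<Sum>i<m. (cmod (x i))\<^sup>2) = (\<Sum>a<m. (cmod (\<Sum>i<m. cnj (U i a) * x i))\<^sup>2)"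
    "\<And>x. qform m A x = of_real (\<Sum>a<m. l a * (cmod (\<Sum>i<m. cnj (U i a) * x i))\<^sup>2)"
    "\<And>s. signed_eig s A = card {a. a < m \<and> s * l a > 0}"
    "det A = (\<Prod>a<m. of_real (l a))"
    by (rule hermitian_diagonalization[OF assms], rule that)
  show ?thesis
  proof (rule that[of "{a. a < m \<and> s * l a > 0}" "\<lambda>a i. cnj (U i a)"])
    show "\<forall>x. (\<forall>a\<in>{a. a < m \<and> s * l a > 0}. (\<Sum>i<m. cnj (U i a) * x i) = 0) \<longrightarrow>
      s * Re (qform m A x) \<le> 0"
    proof (intro allI impI)
      fix x assume x: "\<forall>a\<in>{a. a < m \<and> s * l a > 0}. (\<Sum>i<m. cnj (U i a) * x i) = 0"
      have "(\<Sum>a<m. s * l a * (cmod (\<Sum>i<m. cnj (U i a) * x i))\<^sup>2) \<le> 0"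
      proof (rule sum_nonpos)
        fix a assume "a \<in> {..<m}"
        thus "s * l a * (cmod (\<Sum>i<m. cnj (U i a) * x i))\<^sup>2 \<le> 0"
          using x[rule_format, of a] by (cases "s * l a > 0") (auto intro: mult_nonpos_nonneg)
      qed
      thus "s * Re (qform m A x) \<le> 0" unfolding U(2) by (simp add: sum_distrib_left mult.assoc)
    qed
  qed (auto simp: U(3))
qed

section \<open>Laurent matrices on the unit circle: Hermitian symmetry, continuity and singular
  angles\<close>

lemma lookup_laurent_cnj: "Poly_Mapping.lookup (laurent_cnj g) k = cnj (Poly_Mapping.lookup g (- k))"
proof -
  have "finite (uminus ` Poly_Mapping.keys g)" by simp
  moreover have "{x. cnj (Poly_Mapping.lookup g (- x)) \<noteq> 0} \<subseteq> uminus ` Poly_Mapping.keys g"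
    by (force simp: in_keys_iff image_iff intro: bexI[of _ "- x" for x])
  ultimately have "finite {x. cnj (Poly_Mapping.lookup g (- x)) \<noteq> 0}" by (rule finite_subset[rotated])
  thus ?thesis by (simp add: laurent_cnj_def)
qed

lemma laurent_eval_cis:
  "laurent_eval g (cis \<theta>) = (\<Sum>k\<in>Poly_Mapping.keys g. Poly_Mapping.lookup g k * cis (of_int k * \<theta>))"
  by (simp add: laurent_eval_def cis_power_int)

text \<open>On the unit circle complex conjugation inverts \<open>z\<close>, which matches the
  reversal of exponents.\<close>

lemma laurent_eval_cnj: "laurent_eval (laurent_cnj g) (cis \<theta>) = cnj (laurent_eval g (cis \<theta>))"
proof -
  have "k \<in> Poly_Mapping.keys (laurent_cnj g) \<longleftrightarrow> k \<in> uminus ` Poly_Mapping.keys g" for k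
  proof -
    have "k \<in> uminus ` Poly_Mapping.keys g \<longleftrightarrow> - k \<in> Poly_Mapping.keys g"
      by (metis image_iff minus_minus)
    thus ?thesis by (simp add: in_keys_iff lookup_laurent_cnj)
  qed
  hence "Poly_Mapping.keys (laurent_cnj g) = uminus ` Poly_Mapping.keys g" by blast
  hence "laurent_eval (laurent_cnj g) (cis \<theta>) = (\<Sum>k\<in>uminus ` Poly_Mapping.keys g.
     cnj (Poly_Mapping.lookup g (- k)) * cis (of_int k * \<theta>))"
    by (simp add: laurent_eval_cis lookup_laurent_cnj)
  also have "\<dots> = (\<Sum>k\<in>Poly_Mapping.keys g. cnj (Poly_Mapping.lookup g k) * cis (- (of_int k * \<theta>)))"
    by (subst sum.reindex) (auto simp: inj_on_def)
  also have "\<dots> = cnj (laurent_eval g (cis \<theta>))"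
    by (simp add: laurent_eval_cis cis_cnj)
  finally show ?thesis .
qed

lemma eval_mat_carrier [simp]: "eval_mat m F \<theta> \<in> carrier_mat m m"
  by (simp add: eval_mat_def)

lemma adjoint_eval_mat:
  assumes "self_conjugate m F"
  shows "adjoint_mat (eval_mat m F \<theta>) = eval_mat m F \<theta>"
proof (rule eq_matI)
  fix i j assume "i < dim_row (eval_mat m F \<theta>)" "j < dim_col (eval_mat m F \<theta>)"
  hence ij: "i < m" "j < m" by (auto simp: eval_mat_def)
  hence "F i j = laurent_cnj (F j i)" using assms unfolding self_conjugate_def by blast
  thus "adjoint_mat (eval_mat m F \<theta>) $$ (i, j) = eval_mat m F \<theta> $$ (i, j)"
    using ij by (simp add: eval_mat_def laurent_eval_cnj)
qed (auto simp: eval_mat_def)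

lemma isCont_cis': "isCont f a \<Longrightarrow> isCont (\<lambda>x. cis (f x)) a" for a :: real
  unfolding cis_conv_exp by (intro continuous_intros)

lemma isCont_eval_mat:
  assumes "i < m" "j < m"
  shows "isCont (\<lambda>\<theta>. eval_mat m F \<theta> $$ (i, j)) \<theta>0"
  using assms by (simp add: eval_mat_def laurent_eval_cis) (intro continuous_intros isCont_cis')

text \<open>The determinant of the evaluated matrix is the value of the nonzero Laurent polynomial
  \<open>det F\<close>, and \<open>cis\<close> is injective on a half-open period.\<close>

lemma finite_singular_eval_mat:
  assumes "non_degenerate m F"
  shows "finite {\<theta> \<in> {0..2*pi}. det (eval_mat m F \<theta>) = 0}"
proof -
  define g where "g = det (laurent_mat m F)"
  have "det (eval_mat m F \<theta>) = laurent_eval g (cis \<theta>)" for \<theta>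
  proof -
    interpret comm_ring_hom "\<lambda>g. laurent_eval g (cis \<theta>)" by (rule laurent_eval_hom) simp
    have "eval_mat m F \<theta> = map_mat (\<lambda>g. laurent_eval g (cis \<theta>)) (laurent_mat m F)"
      by (rule eq_matI) (auto simp: eval_mat_def laurent_mat_def)
    thus ?thesis by (simp add: g_def)
  qed
  \<comment> \<open>The right endpoint is added by hand, since \<open>cis\<close> takes the same
    value there as at 0.\<close>
  hence "{\<theta> \<in> {0..2*pi}. det (eval_mat m F \<theta>) = 0} \<subseteq>
     insert (2 * pi) (cis -` {z. z \<noteq> 0 \<and> laurent_eval g z = 0} \<inter> {0..<2*pi})"
    by auto
  moreover have "finite (cis -` {z. z \<noteq> 0 \<and> laurent_eval g z = 0} \<inter> {0..<2*pi})"
  proof (rule finite_vimage_IntI)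
    show "finite {z. z \<noteq> 0 \<and> laurent_eval g z = 0}"
      using assms by (intro finite_laurent_zeros) (simp add: g_def non_degenerate_def)
    show "inj_on cis {0..<2*pi}"
    proof (rule inj_onI)
      fix x y :: real assume xy: "x \<in> {0..<2*pi}" "y \<in> {0..<2*pi}" "cis x = cis y"
      hence "cos x = cos y" "sin x = sin y" by (auto simp: complex_eq_iff)
      hence "cos (x - y) = 1" by (simp add: cos_diff power2_eq_square[symmetric])
      then obtain k :: int where "x - y = of_int k * 2 * pi" by (auto simp: cos_one_2pi_int)
      moreover from this have "\<bar>of_int k * (2 * pi)\<bar> < 1 * (2 * pi)" using xy by auto
      hence "k = 0" unfolding abs_mult by (simp add: abs_mult)
      ultimately show "x = y" by simp
    qed
  qed
  ultimately show ?thesis by (meson finite_insert finite_subset)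
qed

section \<open>Averages of the inertia of \<open>F\<close>\<close>

text \<open>A form that is definite on a subspace stays definite there under small perturbations. If
  the count dropped, this subspace would meet, for dimension reasons, one on which the perturbed
  form is nonpositive.\<close>

lemma signed_eig_lower_semicontinuous:
  assumes A: "\<And>t. A t \<in> carrier_mat m m" "\<And>t. adjoint_mat (A t) = A t"
    and cont: "\<And>i j. i < m \<Longrightarrow> j < m \<Longrightarrow> isCont (\<lambda>t. A t $$ (i, j)) t0"
    and s: "\<bar>s\<bar> = 1"
  shows "eventually (\<lambda>t. signed_eig s (A t0) \<le> signed_eig s (A t)) (nhds (t0 :: 'a :: t2_space))"
proof -
  obtain T :: "nat set" and c \<mu> where T: "finite T" "card T + signed_eig s (A t0) = m" "\<mu> > 0"
    and pos: "\<forall>x. (\<forall>a\<in>T. (\<Sum>i<m. c a i * x i) = (0::complex)) \<longrightarrow>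
      s * Re (qform m (A t0) x) \<ge> \<mu> * (\<Sum>i<m. (cmod (x i))\<^sup>2)"
    by (rule hermitian_definite_subspace[OF A(1)[of t0] A(2)[of t0], of s], rule that)
  \<comment> \<open>Entrywise changes of at most \<epsilon> move the form by at most
    \<open>\<epsilon> * m\<close> times the squared norm, which must stay below \<mu>.\<close>
  define \<epsilon> where "\<epsilon> = \<mu> / (real m + 1)"
  have \<epsilon>: "\<epsilon> > 0" "\<epsilon> * m < \<mu>" using T(3) by (auto simp: \<epsilon>_def field_simps)
  have "eventually (\<lambda>t. dist (A t $$ (i, j)) (A t0 $$ (i, j)) < \<epsilon>) (nhds t0)" if "i < m" "j < m" for i j
    using cont[OF that] \<epsilon>(1) unfolding continuous_at_imp_continuous_at_within isCont_def
    by (auto simp: tendsto_iff eventually_nhds_conv_at)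
  hence "eventually (\<lambda>t. \<forall>i\<in>{..<m}. \<forall>j\<in>{..<m}. dist (A t $$ (i, j)) (A t0 $$ (i, j)) < \<epsilon>) (nhds t0)"
    by (intro eventually_ball_finite ballI) auto
  thus ?thesis
  proof (rule eventually_mono)
    fix t assume close: "\<forall>i\<in>{..<m}. \<forall>j\<in>{..<m}. dist (A t $$ (i, j)) (A t0 $$ (i, j)) < \<epsilon>"
    show "signed_eig s (A t0) \<le> signed_eig s (A t)"
    proof (rule ccontr)
      assume "\<not> signed_eig s (A t0) \<le> signed_eig s (A t)"
      obtain T' :: "nat set" and c' where T': "finite T'" "card T' = signed_eig s (A t)"
        and neg: "\<forall>x. (\<forall>a\<in>T'. (\<Sum>i<m. c' a i * x i) = (0::complex)) \<longrightarrow> s * Re (qform m (A t) x) \<le> 0"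
        by (rule hermitian_nonpositive_subspace[OF A(1)[of t] A(2)[of t], of s], rule that)
      \<comment> \<open>Both families of equations are imposed at once. Their number is
        \<open>m\<close> minus the count at \<open>t0\<close> plus the smaller count at
        \<open>t\<close>, hence less than \<open>m\<close>.\<close>
      have "\<exists>x. (\<exists>i\<in>{..<m}. x i \<noteq> (0::complex)) \<and> (\<forall>i. i \<notin> {..<m} \<longrightarrow> x i = 0) \<and>
         (\<forall>e\<in>T <+> T'. (\<Sum>i\<in>{..<m}. (case e of Inl a \<Rightarrow> c a | Inr a \<Rightarrow> c' a) i * x i) = 0)"
        using T T' \<open>\<not> _\<close> by (intro homogeneous_system_nontrivial_solution) (auto simp: card_Plus)
      then obtain x where x: "\<exists>i\<in>{..<m}. x i \<noteq> 0"
        "\<forall>e\<in>T <+> T'. (\<Sum>i\<in>{..<m}. (case e of Inl a \<Rightarrow> c a | Inr a \<Rightarrow> c' a) i * x i) = 0" by blast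
      have x1: "(\<Sum>i<m. c a i * x i) = 0" if "a \<in> T" for a using bspec[OF x(2) InlI[OF that]] by simp
      have x2: "(\<Sum>i<m. c' a i * x i) = 0" if "a \<in> T'" for a using bspec[OF x(2) InrI[OF that]] by simp
      define X where "X = (\<Sum>i<m. (cmod (x i))\<^sup>2)"
      obtain i where "i \<in> {..<m}" "x i \<noteq> 0" using x(1) by blast
      hence "X > 0" unfolding X_def by (intro sum_pos2[of _ i]) auto
      have "\<mu> * X \<le> s * Re (qform m (A t0) x)" using pos x1 by (simp add: X_def)
      also have "\<dots> \<le> s * Re (qform m (A t0) x) - s * Re (qform m (A t) x)" using neg x2 by simp
      also have "\<dots> = s * Re (qform m (A t0) x - qform m (A t) x)" by (simp add: right_diff_distrib)
      also have "\<dots> \<le> \<bar>s * Re (qform m (A t0) x - qform m (A t) x)\<bar>" by simp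
      also have "\<dots> \<le> cmod (qform m (A t0) x - qform m (A t) x)"
        using s abs_Re_le_cmod by (simp only: abs_mult mult_1)
      also have "qform m (A t0) x - qform m (A t) x = (\<Sum>i<m. \<Sum>j<m. cnj (x i) * (A t0 $$ (i, j) - A t $$ (i, j)) * x j)"
        by (simp add: qform_def sum_subtractf algebra_simps)
      also have "cmod \<dots> \<le> (\<Sum>i<m. \<Sum>j<m. \<epsilon> * (((cmod (x i))\<^sup>2 + (cmod (x j))\<^sup>2) / 2))"
      proof (intro sum_norm_le)
        fix i j assume ij: "i \<in> {..<m}" "j \<in> {..<m}"
        have "cmod (A t0 $$ (i, j) - A t $$ (i, j)) \<le> \<epsilon>"
          using close ij by (metis dist_norm less_imp_le norm_minus_commute)
        moreover have "cmod (x i) * cmod (x j) \<le> ((cmod (x i))\<^sup>2 + (cmod (x j))\<^sup>2) / 2"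
          using sum_squares_bound[of "cmod (x i)" "cmod (x j)"] by simp
        ultimately have "cmod (A t0 $$ (i, j) - A t $$ (i, j)) * (cmod (x i) * cmod (x j)) \<le>
           \<epsilon> * (((cmod (x i))\<^sup>2 + (cmod (x j))\<^sup>2) / 2)"
          using \<epsilon>(1) by (intro mult_mono) auto
        thus "cmod (cnj (x i) * (A t0 $$ (i, j) - A t $$ (i, j)) * x j) \<le> \<epsilon> * (((cmod (x i))\<^sup>2 + (cmod (x j))\<^sup>2) / 2)"
          by (simp add: norm_mult mult_ac)
      qed
      also have "\<dots> = \<epsilon> * m * X"
        by (simp add: sum_distrib_left[symmetric] sum_divide_distrib[symmetric] sum.distrib X_def[symmetric] algebra_simps)
      also have "\<dots> < \<mu> * X" using \<epsilon>(2) \<open>X > 0\<close> by (rule mult_strict_right_mono)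
      finally show False by simp
    qed
  qed
qed

text \<open>By lower semicontinuity the strict superlevel sets are open, so the count is Borel
  measurable; it is also bounded by \<open>m\<close>.\<close>

lemma signed_eig_eval_mat_integrable:
  assumes sc: "self_conjugate m F" and s: "\<bar>s\<bar> = 1"
  shows "(\<lambda>\<theta>. real (signed_eig s (eval_mat m F \<theta>))) integrable_on {a..b}"
proof -
  define g where "g \<theta> = real (signed_eig s (eval_mat m F \<theta>))" for \<theta>
  have "open {\<theta>. y < g \<theta>}" for y
  proof (subst open_subopen, rule ballI)
    fix \<theta>0 assume "\<theta>0 \<in> {\<theta>. y < g \<theta>}"
    moreover have "eventually (\<lambda>\<theta>. g \<theta>0 \<le> g \<theta>) (nhds \<theta>0)"
      unfolding g_def of_nat_le_iff
      by (rule signed_eig_lower_semicontinuous[where m = m and A = "eval_mat m F"]) (auto simp: adjoint_eval_mat[OF sc] isCont_eval_mat s)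
    ultimately have "eventually (\<lambda>\<theta>. \<theta> \<in> {\<theta>. y < g \<theta>}) (nhds \<theta>0)"
      by (auto elim: eventually_mono)
    thus "\<exists>T. open T \<and> \<theta>0 \<in> T \<and> T \<subseteq> {\<theta>. y < g \<theta>}"
      by (auto simp: eventually_nhds)
  qed
  hence "g \<in> borel_measurable borel" by (intro borel_measurableI_greater) auto
  hence "g \<in> borel_measurable (lebesgue_on {a..b})" by (intro measurable_restrict_space1 measurable_completion) simp
  moreover have "\<bar>g \<theta>\<bar> \<le> real m" for \<theta>
    using signed_eig_le[OF eval_mat_carrier adjoint_eval_mat[OF sc]] by (simp add: g_def)
  ultimately have "g integrable_on {a..b}"
    by (rule measurable_bounded_by_integrable_imp_integrable_real[OF _ integrable_const_ivl]) auto
  thus ?thesis by (simp add: g_def[abs_def])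
qed

text \<open>The two counts add up to \<open>m\<close> except at the finitely many singular angles, a
  negligible set.\<close>

lemma integral_signed_eig_complement:
  assumes sc: "self_conjugate m F" and nd: "non_degenerate m F" and s: "\<bar>s\<bar> = 1"
  shows "integral {0..2*pi} (\<lambda>\<theta>. real (signed_eig s (eval_mat m F \<theta>))) +
    integral {0..2*pi} (\<lambda>\<theta>. real (signed_eig (- s) (eval_mat m F \<theta>))) = 2 * pi * m"
proof -
  define g where "g s \<theta> = real (signed_eig s (eval_mat m F \<theta>))" for s \<theta>
  have "integral {0..2*pi} (g s) + integral {0..2*pi} (g (- s)) = integral {0..2*pi} (\<lambda>\<theta>. g s \<theta> + g (- s) \<theta>)"
    unfolding g_def using s by (intro Henstock_Kurzweil_Integration.integral_add[symmetric] signed_eig_eval_mat_integrable sc) auto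
  also have "\<dots> = integral {0..2*pi} (\<lambda>\<theta>. real m)"
  proof (rule integral_spike[OF negligible_finite[OF finite_singular_eval_mat[OF nd]]])
    fix \<theta> assume "\<theta> \<in> {0..2*pi} - {\<theta> \<in> {0..2*pi}. det (eval_mat m F \<theta>) = 0}"
    hence "signed_eig s (eval_mat m F \<theta>) + signed_eig (- s) (eval_mat m F \<theta>) = m"
      using s by (intro signed_eig_complement) (auto simp: adjoint_eval_mat[OF sc])
    thus "real m = g s \<theta> + g (- s) \<theta>" unfolding g_def by linarith
  qed
  also have "\<dots> = 2 * pi * m" by simp
  finally show ?thesis by (simp add: g_def[abs_def])
qed

text \<open>As \<phi> runs over a full period, the \<open>k\<close>-th sample point sweeps the
  \<open>k\<close>-th of \<open>N\<close> equal subintervals at speed \<open>1 / N\<close>. The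
  subintervals tile the period, so the identity is exact.\<close>

lemma has_integral_equispaced_sum:
  fixes g :: "real \<Rightarrow> real"
  assumes g: "g integrable_on {0..2*pi}" and N: "N > 0"
  shows "((\<lambda>\<phi>. \<Sum>k<N. g ((2 * pi * real k + \<phi>) / real N)) has_integral (N * integral {0..2*pi} g)) {0..2*pi}"
proof -
  define p where "p k = 2 * pi * real k / real N" for k
  have p_le: "p k \<le> p l" if "k \<le> l" for k l using that by (auto simp: p_def intro!: divide_right_mono)
  have p0: "p 0 = 0" "p N = 2 * pi" using N by (auto simp: p_def)
  have int: "g integrable_on {p k..p l}" if "l \<le> N" for k l
    by (rule integrable_on_subinterval[OF g]) (use p_le[OF that] p_le[of 0 k] p0 in auto)
  have sum_int: "(\<Sum>k<K. integral {p k..p (Suc k)} g) = integral {p 0..p K} g" if "K \<le> N" for K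
    using that
  proof (induction K)
    case (Suc K)
    have "integral {p 0..p K} g + integral {p K..p (Suc K)} g = integral {p 0..p (Suc K)} g"
      by (rule Henstock_Kurzweil_Integration.integral_combine) (use Suc.prems in \<open>auto intro!: p_le int\<close>)
    thus ?case using Suc by simp
  qed simp
  have "((\<lambda>\<phi>. g ((2 * pi * real k + \<phi>) / real N)) has_integral (N * integral {p k..p (Suc k)} g)) {0..2*pi}"
    if "k < N" for k
  proof -
    have "(g has_integral (integral {p k..p (Suc k)} g)) (cbox (p k) (p (Suc k)))"
      using int[of "Suc k" k] that by (simp add: integrable_integral)
    from has_integral_affinity[OF this, of "1 / real N" "p k"]
    have "((\<lambda>\<phi>. g ((1 / real N) * \<phi> + p k)) has_integral (N * integral {p k..p (Suc k)} g))
       ((\<lambda>x. real N * x + - (real N * p k)) ` {p k..p (Suc k)})"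
      using N by simp
    moreover have "(\<lambda>x. real N * x + - (real N * p k)) ` {p k..p (Suc k)} = {0..2*pi}"
      using N p_le[of k "Suc k"] by (subst image_affinity_atLeastAtMost) (auto simp: p_def field_simps)
    moreover have "(1 / real N) * \<phi> + p k = (2 * pi * real k + \<phi>) / real N" for \<phi>
      by (simp add: p_def add_divide_distrib)
    ultimately show ?thesis by simp
  qed
  hence "((\<lambda>\<phi>. \<Sum>k<N. g ((2 * pi * real k + \<phi>) / real N)) has_integral (\<Sum>k<N. N * integral {p k..p (Suc k)} g)) {0..2*pi}"
    by (intro has_integral_sum finite_lessThan) (simp only: lessThan_iff)
  thus ?thesis using sum_int[of N] by (simp add: sum_distrib_left[symmetric] p0)
qed

section \<open>The inertia bound\<close>

text \<open>Without reduction modulo \<open>n\<close> the maximal cardinality becomes subadditive in \<open>n\<close>.\<close>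

definition exact_independent :: "nat \<Rightarrow> (nat \<Rightarrow> nat \<Rightarrow> int set) \<Rightarrow> nat \<Rightarrow> (nat \<times> nat) set \<Rightarrow> bool" where
  "exact_independent m D n S \<longleftrightarrow> S \<subseteq> bc_vertices m n \<and>
    (\<forall>x\<in>S. \<forall>y\<in>S. int (snd y) - int (snd x) \<notin> D (fst x) (fst y))"

text \<open>Expanding the forms produces the frequencies \<open>u + d - v\<close>, of modulus below
  \<open>n + L\<close> and hence below \<open>N\<close>. Summation over the sample points therefore
  keeps only the terms with \<open>v - u = d\<close>, and independence kills those.\<close>

lemma sum_eval_mat_qform:
  fixes x :: "nat \<times> nat \<Rightarrow> complex"
  assumes bd: "\<And>i j d. i < m \<Longrightarrow> j < m \<Longrightarrow> d \<in> Poly_Mapping.keys (F i j) \<Longrightarrow> \<bar>d\<bar> \<le> int L"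
    and N: "n + L \<le> N" "n > 0"
    and ind: "exact_independent m D n S" and maj: "majorized m F D"
    and x: "\<And>v. v \<notin> S \<Longrightarrow> x v = 0"
  shows "(\<Sum>k<N. qform m (eval_mat m F ((2 * pi * real k + \<phi>) / real N))
     (\<lambda>i. \<Sum>u<n. x (i, u) * cis (- (real u * ((2 * pi * real k + \<phi>) / real N))))) = 0"
proof -
  define \<theta> where "\<theta> k = (2 * pi * real k + \<phi>) / real N" for k
  define co where "co i j u d v = cnj (x (i, u)) * Poly_Mapping.lookup (F i j) d * x (j, v)" for i j u d v
  have p3: "(\<Sum>u\<in>A. a u) * (\<Sum>d\<in>B. b d) * (\<Sum>v\<in>C. c v) = (\<Sum>u\<in>A. \<Sum>d\<in>B. \<Sum>v\<in>C. a u * b d * c v)"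
    for a b c :: "_ \<Rightarrow> complex" and A B C
    by (simp only: mult.assoc sum_distrib_right, simp only: sum_distrib_left)
  have "qform m (eval_mat m F (\<theta> k)) (\<lambda>i. \<Sum>u<n. x (i, u) * cis (- (real u * \<theta> k))) =
     (\<Sum>i<m. \<Sum>j<m. \<Sum>u<n. \<Sum>d\<in>Poly_Mapping.keys (F i j). \<Sum>v<n. co i j u d v * cis (of_int (int u + d - int v) * \<theta> k))" for k
    unfolding qform_def
  proof (intro sum.cong refl)
    fix i j assume ij: "i \<in> {..<m}" "j \<in> {..<m}"
    have e: "cis (real u * t) * cis (of_int d * t) * cis (- (real v * t)) = cis (of_int (int u + d - int v) * t)" for u d v t
      unfolding cis_mult by (rule arg_cong[of _ _ cis]) (simp add: algebra_simps)
    have "cnj (\<Sum>u<n. x (i, u) * cis (- (real u * \<theta> k))) * eval_mat m F (\<theta> k) $$ (i, j) *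
          (\<Sum>u<n. x (j, u) * cis (- (real u * \<theta> k)))
      = (\<Sum>u<n. \<Sum>d\<in>Poly_Mapping.keys (F i j). \<Sum>v<n. (cnj (x (i, u)) * cis (real u * \<theta> k)) *
          (Poly_Mapping.lookup (F i j) d * cis (of_int d * \<theta> k)) * (x (j, v) * cis (- (real v * \<theta> k))))"
      using ij by (simp add: eval_mat_def laurent_eval_cis cis_cnj) (rule p3)
    also have "\<dots> = (\<Sum>u<n. \<Sum>d\<in>Poly_Mapping.keys (F i j). \<Sum>v<n. co i j u d v * cis (of_int (int u + d - int v) * \<theta> k))"
      unfolding co_def e[symmetric] by (intro sum.cong refl) (simp only: mult_ac)
    finally show "cnj (\<Sum>u<n. x (i, u) * cis (- (real u * \<theta> k))) * eval_mat m F (\<theta> k) $$ (i, j) *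
          (\<Sum>u<n. x (j, u) * cis (- (real u * \<theta> k))) = 
       (\<Sum>u<n. \<Sum>d\<in>Poly_Mapping.keys (F i j). \<Sum>v<n. co i j u d v * cis (of_int (int u + d - int v) * \<theta> k))" .
  qed
  hence "(\<Sum>k<N. qform m (eval_mat m F (\<theta> k)) (\<lambda>i. \<Sum>u<n. x (i, u) * cis (- (real u * \<theta> k)))) =
     (\<Sum>i<m. \<Sum>j<m. \<Sum>u<n. \<Sum>d\<in>Poly_Mapping.keys (F i j). \<Sum>v<n.
        co i j u d v * (\<Sum>k<N. cis (of_int (int u + d - int v) * \<theta> k)))"
    by (simp only: sum.swap[of _ _ "{..<N}"] sum_distrib_left)
  also have "\<dots> = 0"
  proof (intro sum.neutral ballI)
    fix i j u d v
    assume *: "i \<in> {..<m}" "j \<in> {..<m}" "u \<in> {..<n}" "d \<in> Poly_Mapping.keys (F i j)" "v \<in> {..<n}"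
    show "co i j u d v * (\<Sum>k<N. cis (of_int (int u + d - int v) * \<theta> k)) = 0"
    proof (cases "int u + d - int v = 0")
      case True
      hence "int v - int u = d" by simp
      moreover have "d \<in> D i j" using * maj unfolding majorized_def by blast
      ultimately have "int v - int u \<in> D i j" by simp
      \<comment> \<open>\<open>d\<close> lies in \<open>D i j\<close> by majorization, so the two
        vertices cannot both belong to \<open>S\<close> and one factor of the coefficient is
        0.\<close>
      hence "(i, u) \<notin> S \<or> (j, v) \<notin> S" using ind by (fastforce simp: exact_independent_def)
      thus ?thesis using x by (auto simp: co_def)
    next
      case False
      have "\<bar>int u + d - int v\<bar> < int N" using * bd[of i j d] N by auto
      hence "(\<Sum>k<N. cis (of_int (int u + d - int v) * \<theta> k)) = 0"
        unfolding \<theta>_def using False by (subst sum_cis_equispaced) auto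
      thus ?thesis by simp
    qed
  qed
  finally show ?thesis unfolding \<theta>_def .
qed

text \<open>If the bound failed, a nonzero \<open>x\<close> on \<open>S\<close> would have all its
  transforms in the definite subspaces. The forms sum to zero, so all transforms vanish, and Fourier
  inversion contradicts \<open>x\<close> being nonzero.\<close>

lemma exact_independent_card_bound:
  assumes sc: "self_conjugate m F" and maj: "majorized m F D"
    and bd: "\<And>i j d. i < m \<Longrightarrow> j < m \<Longrightarrow> d \<in> Poly_Mapping.keys (F i j) \<Longrightarrow> \<bar>d\<bar> \<le> int L"
    and N: "n + L \<le> N" "n > 0"
    and ind: "exact_independent m D n S"
  shows "card S + (\<Sum>k<N. signed_eig s (eval_mat m F ((2 * pi * real k + \<phi>) / real N))) \<le> N * m"
proof (rule ccontr)
  define \<theta> where "\<theta> k = (2 * pi * real k + \<phi>) / real N" for k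
  define A where "A k = eval_mat m F (\<theta> k)" for k
  assume "\<not> ?thesis"
  hence big: "card S + (\<Sum>k<N. signed_eig s (A k)) > N * m" by (simp add: A_def \<theta>_def)
  \<comment> \<open>Bundles the data of a definite subspace, so that one can be chosen for all
    \<open>k\<close> simultaneously.\<close>
  define P where "P k T c \<mu> \<longleftrightarrow> finite T \<and> card T + signed_eig s (A k) = m \<and> \<mu> > 0 \<and>
    (\<forall>x. (\<forall>a\<in>T. (\<Sum>i<m. c a i * x i) = (0::complex)) \<longrightarrow>
      s * Re (qform m (A k) x) \<ge> \<mu> * (\<Sum>i<m. (cmod (x i))\<^sup>2))"
    for k and T :: "nat set" and c :: "nat \<Rightarrow> nat \<Rightarrow> complex" and \<mu> :: real
  have A: "A k \<in> carrier_mat m m" "adjoint_mat (A k) = A k" for k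
    by (simp_all add: A_def adjoint_eval_mat[OF sc])
  have "\<exists>T c \<mu>. P k T c \<mu>" for k
  proof -
    obtain T :: "nat set" and c \<mu> where "finite T" "card T + signed_eig s (A k) = m" "\<mu> > 0"
      "\<forall>x. (\<forall>a\<in>T. (\<Sum>i<m. c a i * x i) = (0::complex)) \<longrightarrow>
        s * Re (qform m (A k) x) \<ge> \<mu> * (\<Sum>i<m. (cmod (x i))\<^sup>2)"
      by (rule hermitian_definite_subspace[OF A(1)[of k] A(2)[of k], of s], rule that)
    hence "P k T c \<mu>" unfolding P_def by blast
    thus ?thesis by blast
  qed
  then obtain T c \<mu> where P: "\<And>k. P k (T k) (c k) (\<mu> k)" by metis
  have T: "finite (T k)" "card (T k) + signed_eig s (A k) = m" "\<mu> k > 0" for k using P[of k] by (auto simp: P_def)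
  have pos: "s * Re (qform m (A k) x) \<ge> \<mu> k * (\<Sum>i<m. (cmod (x i))\<^sup>2)"
    if "\<And>a. a \<in> T k \<Longrightarrow> (\<Sum>i<m. c k a i * x i) = 0" for k x
    using P[of k] that by (auto simp: P_def)
  have S: "S \<subseteq> {..<m} \<times> {..<n}" using ind by (auto simp: exact_independent_def bc_vertices_def)
  hence finS: "finite S" by (rule finite_subset) auto
  \<comment> \<open>There is one equation for each sample point \<open>k\<close> and each index in
    \<open>T k\<close>, against one unknown for each vertex of \<open>S\<close>.\<close>
  have "(\<Sum>k<N. card (T k)) + (\<Sum>k<N. signed_eig s (A k)) = N * m"
    using T(2) by (simp add: sum.distrib[symmetric])
  hence "card (Sigma {..<N} T) < card S" using big T(1) by (simp add: card_SigmaI)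
  moreover have "finite (Sigma {..<N} T)" using T(1) by auto
  ultimately have "\<exists>x. (\<exists>v\<in>S. x v \<noteq> 0) \<and> (\<forall>v. v \<notin> S \<longrightarrow> x v = 0) \<and>
     (\<forall>e\<in>Sigma {..<N} T. (\<Sum>v\<in>S. (c (fst e) (snd e) (fst v) * cis (- (real (snd v) * \<theta> (fst e)))) * x v) = 0)"
    using finS by (intro homogeneous_system_nontrivial_solution)
  then obtain x where x: "\<exists>v\<in>S. x v \<noteq> 0" "\<And>v. v \<notin> S \<Longrightarrow> x v = 0"
    "\<forall>e\<in>Sigma {..<N} T. (\<Sum>v\<in>S. (c (fst e) (snd e) (fst v) * cis (- (real (snd v) * \<theta> (fst e)))) * x v) = 0"
    by blast
  define X where "X k i = (\<Sum>u<n. x (i, u) * cis (- (real u * \<theta> k)))" for k i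
  have "(\<Sum>i<m. c k a i * X k i) = 0" if "k < N" "a \<in> T k" for k a
  proof -
    have "(\<Sum>i<m. c k a i * X k i) = (\<Sum>(i, u)\<in>{..<m} \<times> {..<n}. (c k a i * cis (- (real u * \<theta> k))) * x (i, u))"
      unfolding X_def sum_distrib_left sum.cartesian_product[symmetric]
      by (intro sum.cong refl) (simp only: mult_ac)
    also have "\<dots> = (\<Sum>v\<in>S. (c k a (fst v) * cis (- (real (snd v) * \<theta> k))) * x v)"
      using S x(2) by (intro sum.mono_neutral_cong_right) (auto simp: case_prod_unfold)
    also have "\<dots> = 0" using x(3) that by fastforce
    finally show ?thesis .
  qed
  hence ge: "s * Re (qform m (A k) (X k)) \<ge> \<mu> k * (\<Sum>i<m. (cmod (X k i))\<^sup>2)" if "k < N" for k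
    using pos that by blast
  have nn: "\<mu> k * (\<Sum>i<m. (cmod (X k i))\<^sup>2) \<ge> 0" for k
    using T(3)[of k] by (intro mult_nonneg_nonneg sum_nonneg) auto
  \<comment> \<open>Nonnegative terms are bounded by a sum that vanishes, so each of them, and then
    each \<open>X k i\<close>, is 0.\<close>
  have "(\<Sum>k<N. \<mu> k * (\<Sum>i<m. (cmod (X k i))\<^sup>2)) \<le> (\<Sum>k<N. s * Re (qform m (A k) (X k)))"
    using ge by (intro sum_mono) auto
  also have "\<dots> = s * Re (\<Sum>k<N. qform m (A k) (X k))" by (simp add: sum_distrib_left)
  also have "(\<Sum>k<N. qform m (A k) (X k)) = 0"
    unfolding A_def X_def \<theta>_def by (rule sum_eval_mat_qform[OF bd N ind maj x(2)])
  finally have "(\<Sum>k<N. \<mu> k * (\<Sum>i<m. (cmod (X k i))\<^sup>2)) = 0"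
    using sum_nonneg[of "{..<N}" "\<lambda>k. \<mu> k * (\<Sum>i<m. (cmod (X k i))\<^sup>2)"] nn by simp
  hence Z: "\<mu> k * (\<Sum>i<m. (cmod (X k i))\<^sup>2) = 0" if "k < N" for k
    using that nn by (subst (asm) sum_nonneg_eq_0_iff) auto
  have X0: "X k i = 0" if "k < N" "i < m" for k i
    using Z[OF that(1)] that T(3)[of k] by (simp add: sum_nonneg_eq_0_iff)
  obtain i u0 where iu: "(i, u0) \<in> S" "x (i, u0) \<noteq> 0" using x(1) by auto
  hence lt: "i < m" "u0 < n" using S by auto
  \<comment> \<open>Fourier inversion at \<open>u0\<close>: since \<open>n\<close> \<le>
    \<open>N\<close>, distinct positions below \<open>n\<close> are separated by the sample points,
    and the sum recovers \<open>N\<close> times \<open>x (i, u0)\<close>.\<close>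
  have "0 = (\<Sum>k<N. X k i * cis (real u0 * \<theta> k))" using X0 lt by simp
  also have "\<dots> = (\<Sum>k<N. \<Sum>u<n. x (i, u) * cis (of_int (int u0 - int u) * \<theta> k))"
    unfolding X_def sum_distrib_right mult.assoc cis_mult
    by (intro sum.cong refl arg_cong2[of _ _ _ _ "(*)"] arg_cong[of _ _ cis]) (simp add: algebra_simps)
  also have "\<dots> = (\<Sum>u<n. x (i, u) * (\<Sum>k<N. cis (of_int (int u0 - int u) * \<theta> k)))"
    by (subst sum.swap) (simp add: sum_distrib_left)
  also have "\<dots> = (\<Sum>u<n. if u = u0 then of_nat N * x (i, u) else 0)"
  proof (intro sum.cong refl)
    fix u assume "u \<in> {..<n}"
    hence "(\<Sum>k<N. cis (of_int (int u0 - int u) * \<theta> k)) = (if int u0 - int u = 0 then of_nat N else 0)"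
      unfolding \<theta>_def using lt N by (intro sum_cis_equispaced) auto
    thus "x (i, u) * (\<Sum>k<N. cis (of_int (int u0 - int u) * \<theta> k)) = (if u = u0 then of_nat N * x (i, u) else 0)"
      by auto
  qed
  also have "\<dots> = of_nat N * x (i, u0)" using lt by simp
  finally show False using iu N by simp
qed

text \<open>Averages the discrete bound over the shift \<phi>. It is applied with the sign
  \<open>- s\<close>, because the complement formula then leaves the integral for
  \<open>s\<close>.\<close>

lemma exact_independent_card_integral_bound:
  assumes sc: "self_conjugate m F" and nd: "non_degenerate m F" and maj: "majorized m F D"
    and bd: "\<And>i j d. i < m \<Longrightarrow> j < m \<Longrightarrow> d \<in> Poly_Mapping.keys (F i j) \<Longrightarrow> \<bar>d\<bar> \<le> int L"
    and n: "n > 0" and ind: "exact_independent m D n S" and s: "\<bar>s\<bar> = 1"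
  shows "2 * pi * card S \<le> (n + L) * integral {0..2*pi} (\<lambda>\<theta>. real (signed_eig s (eval_mat m F \<theta>)))"
proof -
  define N where "N = n + L"
  have N: "n + L \<le> N" "N > 0" using n by (auto simp: N_def)
  define g where "g s \<theta> = real (signed_eig s (eval_mat m F \<theta>))" for s \<theta>
  have s': "\<bar>- s\<bar> = 1" using s by simp
  have "((\<lambda>\<phi>. real (card S) + (\<Sum>k<N. g (- s) ((2 * pi * real k + \<phi>) / real N))) has_integral
      (2 * pi * card S + N * integral {0..2*pi} (g (- s)))) {0..2*pi}"
    using has_integral_add[OF has_integral_const_real[of "real (card S)" 0 "2 * pi"]
      has_integral_equispaced_sum[OF signed_eig_eval_mat_integrable[OF sc s'] N(2)]]
    by (simp add: g_def[abs_def])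
  moreover have "((\<lambda>\<phi>. real (N * m)) has_integral (2 * pi * (N * m))) {0..2*pi}"
    using has_integral_const_real[of "real (N * m)" 0 "2 * pi"] by simp
  moreover have "real (card S) + (\<Sum>k<N. g (- s) ((2 * pi * real k + \<phi>) / real N)) \<le> real (N * m)" for \<phi>
    using of_nat_mono[where 'a = real, OF exact_independent_card_bound[where s = "- s" and \<phi> = \<phi>, OF sc maj bd N(1) n ind]]
    by (simp add: g_def)
  ultimately have "2 * pi * card S + N * integral {0..2*pi} (g (- s)) \<le> 2 * pi * (N * m)"
    by (rule has_integral_le)
  moreover have "real N * (integral {0..2*pi} (g s) + integral {0..2*pi} (g (- s))) = real N * (2 * pi * m)"
    using integral_signed_eig_complement[OF sc nd s] by (simp add: g_def[abs_def])
  ultimately have "2 * pi * card S \<le> N * integral {0..2*pi} (g s)" by (simp add: algebra_simps)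
  thus ?thesis by (simp add: N_def g_def[abs_def])
qed

section \<open>Existence of the limit \<open>\<alpha>(D)\<close>\<close>

definition exact_alpha :: "nat \<Rightarrow> (nat \<Rightarrow> nat \<Rightarrow> int set) \<Rightarrow> nat \<Rightarrow> nat" where
  "exact_alpha m D n = Max (card ` {S. exact_independent m D n S})"

lemma bc_vertices_eq: "bc_vertices m n = {..<m} \<times> {..<n}"
  by (auto simp: bc_vertices_def)

lemma finite_bc_vertices [simp]: "finite (bc_vertices m n)"
  by (simp add: bc_vertices_eq)

lemma finite_independent:
  "finite {S. exact_independent m D n S}" "finite {S. bc_independent m D n S}"
  by (rule finite_subset[of _ "Pow (bc_vertices m n)"];
      auto simp: exact_independent_def bc_independent_def)+

lemma empty_independent: "exact_independent m D n {}" "bc_independent m D n {}"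
  by (auto simp: exact_independent_def bc_independent_def)

lemma exact_alpha_attained:
  obtains S where "exact_independent m D n S" "card S = exact_alpha m D n"
proof -
  have "exact_alpha m D n \<in> card ` {S. exact_independent m D n S}"
    unfolding exact_alpha_def using finite_independent(1) empty_independent(1) by (intro Max_in) blast+
  thus ?thesis using that by auto
qed

lemma card_le_exact_alpha: "exact_independent m D n S \<Longrightarrow> card S \<le> exact_alpha m D n"
  unfolding exact_alpha_def using finite_independent(1) by (intro Max_ge) auto

lemma card_le_bc_alpha: "bc_independent m D n S \<Longrightarrow> card S \<le> bc_alpha m D n"
  unfolding bc_alpha_def using finite_independent(2) by (intro Max_ge) auto

lemma bc_independent_imp_exact_independent:
  "bc_independent m D n S \<Longrightarrow> exact_independent m D n S"
  unfolding bc_independent_def exact_independent_def bc_adj_def by blast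

lemma bc_alpha_le_exact_alpha: "bc_alpha m D n \<le> exact_alpha m D n"
proof -
  have "bc_alpha m D n \<in> card ` {S. bc_independent m D n S}"
    unfolding bc_alpha_def using finite_independent(2) empty_independent(2) by (intro Max_in) blast+
  thus ?thesis using card_le_exact_alpha bc_independent_imp_exact_independent by auto
qed

text \<open>The first \<open>n\<close> columns and the last \<open>k\<close> columns of an
  independent set are handled separately; differences do not change when the latter are shifted back
  by \<open>n\<close>.\<close>

lemma exact_alpha_add: "exact_alpha m D (n + k) \<le> exact_alpha m D n + exact_alpha m D k"
proof -
  obtain S where S: "exact_independent m D (n + k) S" "card S = exact_alpha m D (n + k)"
    by (rule exact_alpha_attained)
  have SV: "S \<subseteq> {..<m} \<times> {..<n + k}" and nadj: "\<And>x y. x \<in> S \<Longrightarrow> y \<in> S \<Longrightarrow> int (snd y) - int (snd x) \<notin> D (fst x) (fst y)"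
    using S(1) by (auto simp: exact_independent_def bc_vertices_eq)
  have fin: "finite S" using SV by (rule finite_subset) auto
  define A where "A = {x \<in> S. snd x < n}"
  define B where "B = {x \<in> S. \<not> snd x < n}"
  define f :: "nat \<times> nat \<Rightarrow> nat \<times> nat" where "f x = (fst x, snd x - n)" for x
  have "exact_independent m D n A"
    using SV nadj by (auto simp: exact_independent_def bc_vertices_eq A_def)
  hence "card A \<le> exact_alpha m D n" by (rule card_le_exact_alpha)
  moreover have "exact_independent m D k (f ` B)"
    unfolding exact_independent_def
  proof (intro conjI ballI)
    show "f ` B \<subseteq> bc_vertices m k" using SV by (auto simp: bc_vertices_eq B_def f_def)
    fix x y assume "x \<in> f ` B" "y \<in> f ` B"
    then obtain x' y' where xy: "x' \<in> B" "y' \<in> B" "x = f x'" "y = f y'" by blast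
    have "int (snd y) - int (snd x) = int (snd y') - int (snd x')"
      using xy by (auto simp: B_def f_def)
    thus "int (snd y) - int (snd x) \<notin> D (fst x) (fst y)"
      using nadj[of x' y'] xy by (simp add: B_def f_def)
  qed
  hence "card (f ` B) \<le> exact_alpha m D k" by (rule card_le_exact_alpha)
  moreover have "card (f ` B) = card B"
    by (intro card_image inj_onI) (auto simp: f_def B_def prod_eq_iff)
  moreover have "card S = card A + card B"
    using fin by (subst card_Un_disjoint[symmetric]) (auto simp: A_def B_def intro!: arg_cong[of _ _ card])
  ultimately show ?thesis using S(2) by linarith
qed

text \<open>Removing the last \<open>L\<close> columns makes wrap-around adjacencies impossible.\<close>

lemma exact_alpha_le_bc_alpha:
  assumes bd: "\<And>i j d. i < m \<Longrightarrow> j < m \<Longrightarrow> d \<in> D i j \<Longrightarrow> \<bar>d\<bar> \<le> int L"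
  shows "exact_alpha m D n \<le> bc_alpha m D n + L * m"
proof -
  obtain S where S: "exact_independent m D n S" "card S = exact_alpha m D n"
    by (rule exact_alpha_attained)
  have SV: "S \<subseteq> {..<m} \<times> {..<n}" and nadj: "\<And>x y. x \<in> S \<Longrightarrow> y \<in> S \<Longrightarrow> int (snd y) - int (snd x) \<notin> D (fst x) (fst y)"
    using S(1) by (auto simp: exact_independent_def bc_vertices_eq)
  have fin: "finite S" using SV by (rule finite_subset) auto
  define A where "A = {x \<in> S. snd x + L < n}"
  have "bc_independent m D n A"
    unfolding bc_independent_def
  proof (intro conjI ballI notI)
    show "A \<subseteq> bc_vertices m n" using SV by (auto simp: bc_vertices_eq A_def)
    fix x y assume xy: "x \<in> A" "y \<in> A" "bc_adj D n x y"
    then obtain d where d: "d \<in> D (fst x) (fst y)" "(int (snd y) - int (snd x)) mod int n = d mod int n"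
      by (auto simp: bc_adj_def)
    have "fst x < m" "fst y < m" using xy SV by (auto simp: A_def)
    hence "\<bar>d\<bar> \<le> int L" using bd d(1) by blast
    moreover have "snd x + L < n" "snd y + L < n" using xy by (auto simp: A_def)
    \<comment> \<open>Both positions lie below \<open>n - L\<close>, so their difference has modulus
      less than \<open>n - L\<close>. Congruence modulo \<open>n\<close> then becomes equality,
      contradicting independence without wrap-around.\<close>
    ultimately have "\<bar>int (snd y) - int (snd x) - d\<bar> < int n" by linarith
    moreover have "int n dvd int (snd y) - int (snd x) - d" using d(2) by (simp add: mod_eq_dvd_iff)
    ultimately have "int (snd y) - int (snd x) - d = 0"
      using dvd_imp_le_int[of "int (snd y) - int (snd x) - d" "int n"] by linarith
    thus False using nadj[of x y] xy d(1) by (auto simp: A_def)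
  qed
  hence "card A \<le> bc_alpha m D n" by (rule card_le_bc_alpha)
  moreover have "card (S - A) \<le> card ({..<m} \<times> {n - L..<n})"
    using SV by (intro card_mono) (auto simp: A_def)
  moreover have "card ({..<m} \<times> {n - L..<n}) \<le> L * m" by auto
  moreover have "card S = card A + card (S - A)"
    using fin card_Diff_subset[of A S] card_mono[of S A] by (auto simp: A_def)
  ultimately show ?thesis using S(2) by linarith
qed

text \<open>The cyclic and non-cyclic maxima differ by at most the constant \<open>L * m\<close>, so
  the limit from subadditivity carries over by squeezing. This gives the \<open>lim\<close> in
  \<open>alpha_D\<close> its intended meaning.\<close>

lemma bc_alpha_density_convergent:
  assumes bd: "\<And>i j d. i < m \<Longrightarrow> j < m \<Longrightarrow> d \<in> D i j \<Longrightarrow> \<bar>d\<bar> \<le> int L"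
  shows "convergent (\<lambda>n. real (bc_alpha m D n) / (real n * real m))"
proof -
  have "convergent (\<lambda>n. real (exact_alpha m D n) / real n)"
    by (rule subadditive_limit) (use exact_alpha_add in \<open>auto simp flip: of_nat_add\<close>)
  then obtain c where c: "(\<lambda>n. real (exact_alpha m D n) / real n) \<longlonglongrightarrow> c"
    by (auto simp: convergent_def)
  have "(\<lambda>n. real (L * m) / real n) \<longlonglongrightarrow> 0"
    by (rule real_tendsto_divide_at_top[OF tendsto_const filterlim_real_sequentially])
  from tendsto_diff[OF c this]
  have low: "(\<lambda>n. (real (exact_alpha m D n) - real (L * m)) / real n) \<longlonglongrightarrow> c"
    by (simp add: diff_divide_distrib)
  have "(\<lambda>n. real (bc_alpha m D n) / real n) \<longlonglongrightarrow> c"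
  proof (rule tendsto_sandwich[OF _ _ low c]; rule always_eventually, rule allI)
    fix n
    show "(real (exact_alpha m D n) - real (L * m)) / real n \<le> real (bc_alpha m D n) / real n"
    proof (rule divide_right_mono)
      have "real (exact_alpha m D n) \<le> real (bc_alpha m D n + L * m)"
        by (rule of_nat_mono) (rule exact_alpha_le_bc_alpha[OF bd])
      thus "real (exact_alpha m D n) - real (L * m) \<le> real (bc_alpha m D n)" by simp
    qed simp
    show "real (bc_alpha m D n) / real n \<le> real (exact_alpha m D n) / real n"
      using bc_alpha_le_exact_alpha by (intro divide_right_mono) auto
  qed
  hence "(\<lambda>n. real (bc_alpha m D n) / real n / real m) \<longlonglongrightarrow> c / real m"
    unfolding divide_inverse by (intro tendsto_mult tendsto_const)
  thus ?thesis by (auto simp: convergent_def divide_divide_eq_left)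
qed

section \<open>Passage to the limit in the inertia bound\<close>

lemma diff_matrix_bounded:
  assumes "diff_matrix m D"
  obtains L where "\<And>i j d. i < m \<Longrightarrow> j < m \<Longrightarrow> d \<in> D i j \<Longrightarrow> \<bar>d\<bar> \<le> int L"
proof -
  define K where "K = (\<Union>i<m. \<Union>j<m. (\<lambda>d. nat \<bar>d\<bar>) ` D i j)"
  have "finite (D i j)" if "i < m" "j < m" for i j
    using assms that unfolding diff_matrix_def by blast
  hence "finite K" unfolding K_def by auto
  then obtain L where L: "\<And>k. k \<in> K \<Longrightarrow> k \<le> L" using finite_nat_set_iff_bounded_le by auto
  have "\<bar>d\<bar> \<le> int L" if "i < m" "j < m" "d \<in> D i j" for i j d
    using L[of "nat \<bar>d\<bar>"] that by (force simp: K_def)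
  thus ?thesis using that by blast
qed

text \<open>The integral bound for a largest set without wrap-around also bounds
  \<open>bc_alpha\<close>. After division by \<open>n * m\<close> the enlargement from
  \<open>n\<close> to \<open>n + L\<close> is the factor \<open>1 + L / n\<close>, which tends to
  1.\<close>

lemma alpha_D_le_signed_eig_integral:
  assumes dm: "diff_matrix m D" and sc: "self_conjugate m F" and nd: "non_degenerate m F"
    and maj: "majorized m F D" and s: "\<bar>s\<bar> = 1"
  shows "alpha_D m D \<le> integral {0..2*pi} (\<lambda>\<theta>. real (signed_eig s (eval_mat m F \<theta>))) / (2 * pi * real m)"
proof -
  define I where "I = integral {0..2*pi} (\<lambda>\<theta>. real (signed_eig s (eval_mat m F \<theta>)))"
  obtain L where L: "\<And>i j d. i < m \<Longrightarrow> j < m \<Longrightarrow> d \<in> D i j \<Longrightarrow> \<bar>d\<bar> \<le> int L"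
    using diff_matrix_bounded[OF dm] by blast
  have LF: "\<bar>d\<bar> \<le> int L" if "i < m" "j < m" "d \<in> Poly_Mapping.keys (F i j)" for i j d
    using that maj L unfolding majorized_def by blast
  have lim: "(\<lambda>n. real (bc_alpha m D n) / (real n * real m)) \<longlonglongrightarrow> alpha_D m D"
    unfolding alpha_D_def using bc_alpha_density_convergent[OF L] by (simp add: convergent_LIMSEQ_iff)
  have bound: "real (bc_alpha m D n) / (real n * real m) \<le> (1 + real L / real n) * (I / (2 * pi * real m))"
    if n: "n > 0" for n
  proof -
    obtain S where S: "exact_independent m D n S" "card S = exact_alpha m D n"
      by (rule exact_alpha_attained)
    have "2 * pi * real (bc_alpha m D n) \<le> 2 * pi * real (card S)"
      using bc_alpha_le_exact_alpha[of m D n] S(2) by simp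
    also have "\<dots> \<le> real (n + L) * I"
      using exact_independent_card_integral_bound[OF sc nd maj LF n S(1) s] by (simp add: I_def)
    finally have "real (bc_alpha m D n) \<le> real (n + L) * I / (2 * pi)" by (simp add: field_simps)
    hence "real (bc_alpha m D n) / (real n * real m) \<le> real (n + L) * I / (2 * pi) / (real n * real m)"
      by (rule divide_right_mono) simp
    also have "\<dots> = (1 + real L / real n) * (I / (2 * pi * real m))"
      using n by (simp add: field_simps)
    finally show ?thesis .
  qed
  have "(\<lambda>n. (1 + real L / real n) * (I / (2 * pi * real m))) \<longlonglongrightarrow> (1 + 0) * (I / (2 * pi * real m))"
    by (intro tendsto_intros real_tendsto_divide_at_top[OF tendsto_const filterlim_real_sequentially])
  moreover have "\<exists>N. \<forall>n\<ge>N. real (bc_alpha m D n) / (real n * real m) \<le>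
      (1 + real L / real n) * (I / (2 * pi * real m))"
    by (rule exI[of _ 1]) (use bound in simp)
  ultimately have "alpha_D m D \<le> (1 + 0) * (I / (2 * pi * real m))"
    by (rule LIMSEQ_le[OF lim])
  thus ?thesis by (simp add: I_def)
qed

theorem theorem9:
  fixes m :: nat and D :: "nat \<Rightarrow> nat \<Rightarrow> int set" and F :: "nat \<Rightarrow> nat \<Rightarrow> laurent"
  assumes "diff_matrix m D"
    and "self_conjugate m F"
    and "non_degenerate m F"
    and "majorized m F D"
  shows "alpha_D m D \<le> min (rho_plus m F) (rho_minus m F)"
  using alpha_D_le_signed_eig_integral[OF assms, of 1] alpha_D_le_signed_eig_integral[OF assms, of "- 1"]
  by (simp add: rho_plus_def rho_minus_def num_pos_eig_eq num_neg_eig_eq)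

end
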